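(* Let $k$ be a field of characteristic $2$ and let $L$ be a Lie superalgebra in $\mathrm{Ver}_4^+(k)$ with super-structure $(L_0,L_1)$ and squaring map $Q:L_1\to L_0$. Then the natural surjective algebra map $$SL/(L_1^2)\longrightarrow \operatorname{gr}U_{\rm super}(L)$$ is an isomorphism.
   Context: $k$ is a field of characteristic $2$. $\mathrm{Ver}_4^+(k)$ is the symmetric tensor category of (possibly infinite dimensional) $k$-vector spaces $V$ with a linear map $D:V\to V$, $D^2=0$ (write $x'=Dx$); on $V\otimes W$, $D(v\otimes w)=v'\otimes w+v\otimes w'$; the braiding is $c(v\otimes w)=w\otimes v+w'\otimes v'$. An operadic Lie algebra in $\mathrm{Ver}_4^+(k)$ is an object $L$ with a $k$-bilinear bracket such that for all $x,y,z$: $[x,y]'=[x',y]+[x,y']$; $[x,y]=[y,x]+[y',x']$; and $[[x,y],z]+[[z,x],y]+[[y,z],x]+[[x',y],z']+[[z',x],y']+[[y',z],x']=0$. It is a Lie algebra if moreover $[x,x]=0$ whenever $x'=0$. A super-structure on $L$ is a pair of subspaces $\operatorname{Im}D\subset L_0,L_1\subset\operatorname{Ker}D$ with $L_0\cap L_1=\operatorname{Im}D$ and $L_0+L_1=\operatorname{Ker}D$. A map $Q$ between $k$-vector spaces is quadratic if $Q(\lambda y)=\lambda^2Q(y)$ for $\lambda \in k$ and $Q(y_1+y_2)-Q(y_1)-Q(y_2)$ is bilinear. A Lie superalgebra in $\mathrm{Ver}_4^+(k)$ is a Lie algebra $L$ in $\mathrm{Ver}_4^+(k)$ with a super-structure $L_0,L_1$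 such that $[L_i,L_j]\subset L_{i+j}$ (indices mod $2$), and a quadratic map $Q:L_1\to L_0$ such that $Q(x')=[x,x]$ for $x\in L$; $Q(y_1+y_2)-Q(y_1)-Q(y_2)=[y_1,y_2]$ for $y_1,y_2\in L_1$; $[Q(y),x]=[y,[y,x]]$ for $y\in L_1$, $x\in L$. $U(L)$ is the quotient of the tensor algebra $TL$ by the two-sided ideal generated by $x\otimes y-y\otimes x-y'\otimes x'-[x,y]$, $x,y\in L$. $SL$ is the quotient of $TL$ by the two-sided ideal generated by $x\otimes y-y\otimes x-y'\otimes x'$. $U_{\rm super}(L):=U(L)/(y^2-Q(y),\ y\in L_1)$, with the increasing filtration induced by degree in $TL$, and $\operatorname{gr}$ is the associated graded algebra. $SL/(L_1^2)$ is the quotient of $SL$ by the two-sided ideal generated by the squares $y^2$, $y\in L_1$. The natural map is the algebra map induced by sending $x\in L$ to its class in degree $1$ of $\operatorname{gr}U_{\rm super}(L)$. *)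

theory Defs
  imports
    Complex_Main
    "HOL-Library.Poly_Mapping"
    "HOL-Algebra.QuotRing"
    "HOL-Algebra.Module"
begin

section \<open>Lie superalgebras in Ver4+(k)\<close>

locale ver4_object = vector_space scale
  for scale :: "'k::field \<Rightarrow> 'l::ab_group_add \<Rightarrow> 'l" +
  fixes D :: "'l \<Rightarrow> 'l"
  assumes char_two: "CHAR('k) = 2"
    and linear_D: "Vector_Spaces.linear scale scale D"
    and D_square: "D (D x) = 0"

locale operadic_lie_algebra = ver4_object scale D
  for scale :: "'k::field \<Rightarrow> 'l::ab_group_add \<Rightarrow> 'l" and D :: "'l \<Rightarrow> 'l" +
  fixes br :: "'l \<Rightarrow> 'l \<Rightarrow> 'l"
  assumes linear_br_left: "Vector_Spaces.linear scale scale (\<lambda>x. br x y)"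
    and linear_br_right: "Vector_Spaces.linear scale scale (\<lambda>y. br x y)"
    and D_br: "D (br x y) = br (D x) y + br x (D y)"
    and br_commute: "br x y = br y x + br (D y) (D x)"
    and jacobi: "br (br x y) z + br (br z x) y + br (br y z) x
      + br (br (D x) y) (D z) + br (br (D z) x) (D y) + br (br (D y) z) (D x) = 0"

locale lie_algebra = operadic_lie_algebra scale D br
  for scale :: "'k::field \<Rightarrow> 'l::ab_group_add \<Rightarrow> 'l" and D :: "'l \<Rightarrow> 'l"
    and br :: "'l \<Rightarrow> 'l \<Rightarrow> 'l" +
  assumes br_self: "D x = 0 \<Longrightarrow> br x x = 0"

locale super_structure = ver4_object scale D
  for scale :: "'k::field \<Rightarrow> 'l::ab_group_add \<Rightarrow> 'l" and D :: "'l \<Rightarrow> 'l" +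
  fixes L0 L1 :: "'l set"
  assumes subspace_L0: "subspace L0"
    and subspace_L1: "subspace L1"
    and image_D_L0: "range D \<subseteq> L0"
    and image_D_L1: "range D \<subseteq> L1"
    and L0_kernel: "L0 \<subseteq> {x. D x = 0}"
    and L1_kernel: "L1 \<subseteq> {x. D x = 0}"
    and L0_inter_L1: "L0 \<inter> L1 = range D"
    and L0_plus_L1: "{a + b |a b. a \<in> L0 \<and> b \<in> L1} = {x. D x = 0}"

definition polar_form :: "('l::ab_group_add \<Rightarrow> 'l) \<Rightarrow> 'l \<Rightarrow> 'l \<Rightarrow> 'l"
  where "polar_form Q x y = Q (x + y) - Q x - Q y"

definition quadratic_map_on ::
  "('k::field \<Rightarrow> 'l::ab_group_add \<Rightarrow> 'l) \<Rightarrow> 'l set \<Rightarrow> 'l set \<Rightarrow> ('l \<Rightarrow> 'l) \<Rightarrow> bool"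
  where "quadratic_map_on scale V W Q \<longleftrightarrow>
    Q \<in> V \<rightarrow> W \<and>
    (\<forall>c. \<forall>y\<in>V. Q (scale c y) = scale (c ^ 2) (Q y)) \<and>
    (\<forall>x\<in>V. \<forall>y\<in>V. \<forall>z\<in>V.
        polar_form Q (x + y) z = polar_form Q x z + polar_form Q y z \<and>
        polar_form Q z (x + y) = polar_form Q z x + polar_form Q z y) \<and>
    (\<forall>c. \<forall>x\<in>V. \<forall>y\<in>V.
        polar_form Q (scale c x) y = scale c (polar_form Q x y) \<and>
        polar_form Q x (scale c y) = scale c (polar_form Q x y))"

locale lie_superalgebra =
  lie_algebra scale D br + super_structure scale D L0 L1
  for scale :: "'k::field \<Rightarrow> 'l::ab_group_add \<Rightarrow> 'l" and D :: "'l \<Rightarrow> 'l"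
    and br :: "'l \<Rightarrow> 'l \<Rightarrow> 'l" and L0 L1 :: "'l set" +
  fixes Q :: "'l \<Rightarrow> 'l"
  assumes br_L0_L0: "x \<in> L0 \<Longrightarrow> y \<in> L0 \<Longrightarrow> br x y \<in> L0"
    and br_L0_L1: "x \<in> L0 \<Longrightarrow> y \<in> L1 \<Longrightarrow> br x y \<in> L1"
    and br_L1_L0: "x \<in> L1 \<Longrightarrow> y \<in> L0 \<Longrightarrow> br x y \<in> L1"
    and br_L1_L1: "x \<in> L1 \<Longrightarrow> y \<in> L1 \<Longrightarrow> br x y \<in> L0"
    and quadratic_Q: "quadratic_map_on scale L1 L0 Q"
    and Q_D: "Q (D x) = br x x"
    and Q_polar: "y1 \<in> L1 \<Longrightarrow> y2 \<in> L1 \<Longrightarrow> Q (y1 + y2) - Q y1 - Q y2 = br y1 y2"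
    and br_Q: "y \<in> L1 \<Longrightarrow> br (Q y) x = br y (br y x)"


section \<open>Associative algebras, quotients and associated graded algebras\<close>

text \<open>
  A unital, not necessarily commutative, associative \<open>k\<close>-algebra is represented by the record
  type \<^typ>\<open>('k, 'a) module\<close> (a ring together with a scalar multiplication).  The coset operations
  below follow \<^const>\<open>FactRing\<close>.
\<close>

definition coset_smult ::
  "('k, 'a, 'm) module_scheme \<Rightarrow> 'a set \<Rightarrow> 'k \<Rightarrow> 'a set \<Rightarrow> 'a set"
  where "coset_smult A N c X = (\<Union>x\<in>X. N +>\<^bsub>A\<^esub> (c \<odot>\<^bsub>A\<^esub> x))"

text \<open>
  The quotient by the two-sided ideal generated by \<open>S\<close>.  As the algebras are unital, ring ideals
  are closed under scalar multiplication.
\<close>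

definition quot_alg :: "('k, 'a, 'm) module_scheme \<Rightarrow> 'a set \<Rightarrow> ('k, 'a set) module"
  where "quot_alg A S =
    (let I = Idl\<^bsub>A\<^esub> S; R = A Quot I in
      \<lparr>carrier = carrier R, mult = mult R, one = one R, zero = zero R, add = add R,
       smult = coset_smult A I\<rparr>)"

definition quot_proj :: "('k, 'a, 'm) module_scheme \<Rightarrow> 'a set \<Rightarrow> 'a \<Rightarrow> 'a set"
  where "quot_proj A S a = (Idl\<^bsub>A\<^esub> S) +>\<^bsub>A\<^esub> a"

definition alg_hom ::
  "('k, 'a, 'm) module_scheme \<Rightarrow> ('k, 'b, 'n) module_scheme \<Rightarrow> ('a \<Rightarrow> 'b) set"
  where "alg_hom A B =
    {h \<in> ring_hom A B. \<forall>c. \<forall>a\<in>carrier A. h (c \<odot>\<^bsub>A\<^esub> a) = c \<odot>\<^bsub>B\<^esub> h a}"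

definition alg_iso ::
  "('k, 'a, 'm) module_scheme \<Rightarrow> ('k, 'b, 'n) module_scheme \<Rightarrow> ('a \<Rightarrow> 'b) set"
  where "alg_iso A B = {h \<in> alg_hom A B. bij_betw h (carrier A) (carrier B)}"

text \<open>
  An increasing filtration is given by \<open>F 0 \<subseteq> F 1 \<subseteq> \<dots>\<close>; \<open>fil_pred A F n\<close> is the step below \<open>F n\<close>,
  with \<open>F (-1) = 0\<close>.
\<close>

definition fil_pred :: "('k, 'a, 'm) module_scheme \<Rightarrow> (nat \<Rightarrow> 'a set) \<Rightarrow> nat \<Rightarrow> 'a set"
  where "fil_pred A F n = (case n of 0 \<Rightarrow> {\<zero>\<^bsub>A\<^esub>} | Suc m \<Rightarrow> F m)"

definition gr_class ::
  "('k, 'a, 'm) module_scheme \<Rightarrow> (nat \<Rightarrow> 'a set) \<Rightarrow> nat \<Rightarrow> 'a \<Rightarrow> (nat \<Rightarrow> 'a set)"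
  where "gr_class A F n a =
    (\<lambda>m. if m = n then fil_pred A F n +>\<^bsub>A\<^esub> a else fil_pred A F m)"

text \<open>
  The direct sum of the quotients \<open>F n / F (n - 1)\<close>: an element is a finitely supported family of
  cosets, the zero of degree \<open>n\<close> being the coset \<open>fil_pred A F n\<close>.  The product is determined by
  \<open>[a] \<cdot> [b] = [a b]\<close>, where \<open>[a b]\<close> has degree \<open>i + j\<close> if \<open>[a]\<close> and \<open>[b]\<close> have degrees \<open>i\<close> and \<open>j\<close>;
  as in \<^const>\<open>rcoset_mult\<close>, the union over all representatives is a single coset for a
  multiplicative filtration.
\<close>

definition gr_mult ::
  "('k, 'a, 'm) module_scheme \<Rightarrow> (nat \<Rightarrow> 'a set) \<Rightarrow> (nat \<Rightarrow> 'a set) \<Rightarrow> (nat \<Rightarrow> 'a set) \<Rightarrow> (nat \<Rightarrow> 'a set)"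
  where "gr_mult A F g h =
    (\<lambda>n. \<Union>a\<in>{a. \<forall>i\<le>n. a i \<in> g i}. \<Union>b\<in>{b. \<forall>i\<le>n. b i \<in> h i}.
      fil_pred A F n +>\<^bsub>A\<^esub> (\<Oplus>\<^bsub>A\<^esub>i\<in>{..n}. a i \<otimes>\<^bsub>A\<^esub> b (n - i)))"

definition gr_alg ::
  "('k, 'a, 'm) module_scheme \<Rightarrow> (nat \<Rightarrow> 'a set) \<Rightarrow> ('k, nat \<Rightarrow> 'a set) module"
  where "gr_alg A F =
    \<lparr>carrier = {g. (\<forall>n. g n \<in> (\<lambda>a. fil_pred A F n +>\<^bsub>A\<^esub> a) ` F n) \<and>
                   finite {n. g n \<noteq> fil_pred A F n}},
     mult = gr_mult A F,
     one = gr_class A F 0 \<one>\<^bsub>A\<^esub>,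
     zero = fil_pred A F,
     add = (\<lambda>g h n. g n <+>\<^bsub>A\<^esub> h n),
     smult = (\<lambda>c g n. coset_smult A (fil_pred A F n) c (g n))\<rparr>"


section \<open>The tensor algebra\<close>

datatype 'l word = Word (letters: "'l list")

instantiation word :: (type) monoid_add
begin

definition zero_word :: "'a word"
  where "zero_word = Word []"

definition plus_word :: "'a word \<Rightarrow> 'a word \<Rightarrow> 'a word"
  where "plus_word u v = Word (letters u @ letters v)"

instance
  by standard (simp_all add: zero_word_def plus_word_def)

end

text \<open>The monoid algebra of the words over the underlying set of \<open>L\<close>.\<close>

definition free_alg :: "('k::field, 'l word \<Rightarrow>\<^sub>0 'k) module"
  where "free_alg =
    \<lparr>carrier = UNIV, mult = (*), one = 1, zero = 0, add = (+),
     smult = (\<lambda>c p. Poly_Mapping.single 0 c * p)\<rparr>"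

definition word_mono :: "'l list \<Rightarrow> ('l word \<Rightarrow>\<^sub>0 'k::field)"
  where "word_mono xs = Poly_Mapping.single (Word xs) 1"

text \<open>
  The words of length \<open>n\<close> span the free vector space on \<open>L\<^sup>n\<close>; dividing it by the relations below
  of length \<open>n\<close> gives the \<open>n\<close>-th tensor power of \<open>L\<close>.
\<close>

definition multilinear_rels ::
  "('k::field \<Rightarrow> 'l::ab_group_add \<Rightarrow> 'l) \<Rightarrow> ('l word \<Rightarrow>\<^sub>0 'k) set"
  where "multilinear_rels scale =
    {word_mono (us @ [x + y] @ vs) - word_mono (us @ [x] @ vs) - word_mono (us @ [y] @ vs) |us vs x y. True} \<union>
    {word_mono (us @ [scale c x] @ vs) - Poly_Mapping.single 0 c * word_mono (us @ [x] @ vs) |us vs c x. True}"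

definition tensor_alg ::
  "('k::field \<Rightarrow> 'l::ab_group_add \<Rightarrow> 'l) \<Rightarrow> ('k, ('l word \<Rightarrow>\<^sub>0 'k) set) module"
  where "tensor_alg scale = quot_alg free_alg (multilinear_rels scale)"

definition tensor_gen ::
  "('k::field \<Rightarrow> 'l::ab_group_add \<Rightarrow> 'l) \<Rightarrow> 'l \<Rightarrow> ('l word \<Rightarrow>\<^sub>0 'k) set"
  where "tensor_gen scale x = quot_proj free_alg (multilinear_rels scale) (word_mono [x])"

text \<open>The sum of the tensor powers of degree at most \<open>n\<close>.\<close>

definition tensor_le ::
  "('k::field \<Rightarrow> 'l::ab_group_add \<Rightarrow> 'l) \<Rightarrow> nat \<Rightarrow> ('l word \<Rightarrow>\<^sub>0 'k) set set"
  where "tensor_le scale n =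
    quot_proj free_alg (multilinear_rels scale) `
      {p. \<forall>w\<in>Poly_Mapping.keys p. length (letters w) \<le> n}"


section \<open>Symmetric and enveloping algebras\<close>

definition sym_rels ::
  "('k::field \<Rightarrow> 'l::ab_group_add \<Rightarrow> 'l) \<Rightarrow> ('l \<Rightarrow> 'l) \<Rightarrow> ('l word \<Rightarrow>\<^sub>0 'k) set set"
  where "sym_rels scale D =
    (let T = tensor_alg scale; t = tensor_gen scale in
      {t x \<otimes>\<^bsub>T\<^esub> t y \<ominus>\<^bsub>T\<^esub> t y \<otimes>\<^bsub>T\<^esub> t x \<ominus>\<^bsub>T\<^esub> t (D y) \<otimes>\<^bsub>T\<^esub> t (D x) |x y. True})"

definition sym_alg where
  "sym_alg scale D = quot_alg (tensor_alg scale) (sym_rels scale D)"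

definition sym_gen where
  "sym_gen scale D x = quot_proj (tensor_alg scale) (sym_rels scale D) (tensor_gen scale x)"

definition square_rels where
  "square_rels scale D L1 =
    {sym_gen scale D y \<otimes>\<^bsub>sym_alg scale D\<^esub> sym_gen scale D y |y. y \<in> L1}"

definition sym_super_alg where
  "sym_super_alg scale D L1 = quot_alg (sym_alg scale D) (square_rels scale D L1)"

definition sym_super_gen where
  "sym_super_gen scale D L1 x =
    quot_proj (sym_alg scale D) (square_rels scale D L1) (sym_gen scale D x)"

definition env_rels ::
  "('k::field \<Rightarrow> 'l::ab_group_add \<Rightarrow> 'l) \<Rightarrow> ('l \<Rightarrow> 'l) \<Rightarrow> ('l \<Rightarrow> 'l \<Rightarrow> 'l) \<Rightarrow>
    ('l word \<Rightarrow>\<^sub>0 'k) set set"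
  where "env_rels scale D br =
    (let T = tensor_alg scale; t = tensor_gen scale in
      {t x \<otimes>\<^bsub>T\<^esub> t y \<ominus>\<^bsub>T\<^esub> t y \<otimes>\<^bsub>T\<^esub> t x \<ominus>\<^bsub>T\<^esub> t (D y) \<otimes>\<^bsub>T\<^esub> t (D x) \<ominus>\<^bsub>T\<^esub> t (br x y) |x y. True})"

definition env_alg where
  "env_alg scale D br = quot_alg (tensor_alg scale) (env_rels scale D br)"

definition env_gen where
  "env_gen scale D br x =
    quot_proj (tensor_alg scale) (env_rels scale D br) (tensor_gen scale x)"

definition super_rels where
  "super_rels scale D br L1 Q =
    {env_gen scale D br y \<otimes>\<^bsub>env_alg scale D br\<^esub> env_gen scale D br y
       \<ominus>\<^bsub>env_alg scale D br\<^esub> env_gen scale D br (Q y) |y. y \<in> L1}"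

definition super_env_alg where
  "super_env_alg scale D br L1 Q =
    quot_alg (env_alg scale D br) (super_rels scale D br L1 Q)"

definition super_env_gen where
  "super_env_gen scale D br L1 Q x =
    quot_proj (env_alg scale D br) (super_rels scale D br L1 Q) (env_gen scale D br x)"

definition super_env_le where
  "super_env_le scale D br L1 Q n =
    (\<lambda>t. quot_proj (env_alg scale D br) (super_rels scale D br L1 Q)
           (quot_proj (tensor_alg scale) (env_rels scale D br) t)) ` tensor_le scale n"

definition gr_super_env_alg where
  "gr_super_env_alg scale D br L1 Q =
    gr_alg (super_env_alg scale D br L1 Q) (super_env_le scale D br L1 Q)"

text \<open>
  The algebra maps with the prescribed values on the generators; extensionality makes maps that
  agree on the carrier equal.
\<close>

definition natural_maps where
  "natural_maps scale D br L1 Q =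
    {h \<in> alg_hom (sym_super_alg scale D L1) (gr_super_env_alg scale D br L1 Q)
         \<inter> extensional (carrier (sym_super_alg scale D L1)).
      \<forall>x. h (sym_super_gen scale D L1 x) =
        gr_class (super_env_alg scale D br L1 Q) (super_env_le scale D br L1 Q) 1
          (super_env_gen scale D br L1 Q x)}"

end

theory Submission
  imports Defs
begin

text \<open>
  Sending an element of the free algebra on words to the classes of its homogeneous components is a
  surjective algebra map to \<open>gr U\<close> (\<open>symbol_hom\<close>, \<open>symbol_surj\<close>).  The natural map is induced by
  it, hence unique and surjective.  What has to be shown is injectivity: if \<open>q\<close> is homogeneous of
  degree \<open>n\<close> and \<open>q - t\<close> is a relation of \<open>U(L)/(y\<^sup>2 - Q(y))\<close> for some \<open>t\<close> of degree below \<open>n\<close>, then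
  \<open>q\<close> is a relation of \<open>SL/(L1\<^sup>2)\<close>.  This is clear when \<open>q - t\<close> is a combination of products \<open>u g v\<close>
  of words with a defining relation \<open>g\<close> that all have length at most \<open>n\<close>, since the part of degree
  two of \<open>g\<close> is a relation of \<open>SL/(L1\<^sup>2)\<close>.  The danger is a combination of longer products whose
  long parts cancel.

  That this does no harm is a confluence argument.  Take a basis of \<open>L\<close> adapted to
  \<open>L1 \<subseteq> Ker D \<subseteq> L\<close> and order it with the part in \<open>Ker D\<close> first.  The relations become rewriting rules
  \<open>a b \<rightarrow> b a + b' a' + [a, b]\<close> for \<open>a > b\<close> and \<open>c c \<rightarrow> Q(c)\<close> for \<open>c\<close> in \<open>L1\<close>.  If \<open>b' a'\<close> is not zero,
  then \<open>a\<close> lies outside \<open>Ker D\<close> and so comes after all letters of \<open>b' a'\<close>: the right hand sides are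
  smaller in the length-lexicographic order.  The overlaps are resolved by the axioms.  A decreasing
  word \<open>x y z\<close> needs the Jacobi identity at \<open>x, y, z\<close> and once more at \<open>x', y, z'\<close>
  (\<open>overlap_identity\<close>); the words \<open>x x z\<close> and \<open>x y y\<close> need \<open>[Q(y), x] = [y, [y, x]]\<close>; the word
  \<open>x x x\<close> needs \<open>[x, [x, x]] = 0\<close>.  Confluence implies that a combination of the \<open>u g v\<close> can be
  rewritten so that no leading word exceeds all the words that occur in the combination
  (\<open>reduction_controlled_by_keys\<close>), and in particular no leading word is longer than these.  Taking
  the component of degree \<open>n\<close> finishes the proof (\<open>symbol_of_relation\<close>).
\<close>

alias single = Poly_Mapping.single
alias keys = Poly_Mapping.keys
alias lookup = Poly_Mapping.lookup

section \<open>The free algebra on words\<close>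

text \<open>
  A constant of its own lets scalars be pulled out of products by terminating rewriting: as products
  with \<open>single 0 c\<close> two scalars could be exchanged forever.
\<close>
definition scalar_mult :: "'k::field \<Rightarrow> ('w::monoid_add \<Rightarrow>\<^sub>0 'k) \<Rightarrow> ('w \<Rightarrow>\<^sub>0 'k)"  (infixr \<open>\<star>\<close> 75)
  where "c \<star> p = single 0 c * p"

lemma lookup_scale: "lookup (c \<star> p) w = c * lookup p w"
  unfolding scalar_mult_def mult_map_scale_conv_mult[symmetric] by transfer (auto simp: when_def)

lemma poly_mapping_single_induct [case_names zero add]:
  assumes "P 0" and "\<And>w c p. P p \<Longrightarrow> P (single w c + p)"
  shows "P (p :: 'w \<Rightarrow>\<^sub>0 'k::ab_group_add)"
proof (induction p rule: update_induct)
  case (update f a b)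
  have "Poly_Mapping.update a b f = single a b + f"
    using update(1) by (intro poly_mapping_eqI)
      (auto simp: lookup_update lookup_add lookup_single in_keys_iff)
  then show ?case using assms(2) update by simp
qed (rule assms)

lemma scale_mult_left: "(c \<star> p) * q = c \<star> (p * q)"
  by (simp add: scalar_mult_def mult.assoc)

lemma scale_mult_right: "p * (c \<star> q) = c \<star> (p * q)"
proof -
  have "p * single 0 c = single 0 c * p"
    by (induction p rule: poly_mapping_single_induct)
      (simp_all add: distrib_left distrib_right mult_single mult.commute)
  then show ?thesis by (simp add: scalar_mult_def mult.assoc[symmetric])
qed

lemmas scale_mult = scale_mult_left scale_mult_right

interpretation fa: vector_space scalar_mult
  by unfold_locales
    (simp_all add: scalar_mult_def distrib_left distrib_right single_add mult.assoc[symmetric] mult_single)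

lemma scale_single: "c \<star> single w d = single w (c * d)"
  by (simp add: scalar_mult_def mult_single)

lemma word_mono_Nil: "word_mono [] = 1"
  by (simp add: word_mono_def zero_word_def[symmetric])

lemma word_mono_append: "word_mono u * word_mono v = word_mono (u @ v)"
  by (simp add: word_mono_def mult_single plus_word_def)

lemma lookup_word_mono: "lookup (word_mono u) w = (if w = Word u then 1 else 0)"
  by (simp add: word_mono_def lookup_single when_def)

lemma keys_word_mono [simp]: "keys (word_mono u :: 'l word \<Rightarrow>\<^sub>0 'k::field) = {Word u}"
  by (simp add: word_mono_def)

lemma single_eq_scale: "single w c = c \<star> word_mono (letters w)"
  by (simp add: word_mono_def scale_single)

lemma span_word_mono: "p \<in> fa.span (word_mono ` {xs. Word xs \<in> keys p})"
proof -
  have "p = (\<Sum>w\<in>keys p. single w (lookup p w))"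
    by (intro poly_mapping_eqI) (simp add: lookup_sum lookup_single when_def in_keys_iff)
  also have "\<dots> \<in> fa.span (word_mono ` {xs. Word xs \<in> keys p})"
    unfolding single_eq_scale by (intro fa.span_sum fa.span_scale fa.span_base) auto
  finally show ?thesis .
qed

lemma keys_in_span:
  assumes "p \<in> fa.span S" "\<And>s. s \<in> S \<Longrightarrow> keys s \<subseteq> W"
  shows "keys p \<subseteq> W"
  using assms(1)
proof (induction rule: fa.span_induct_alt)
  case (step c x y)
  have "keys (c \<star> x) \<subseteq> keys x"
    by (auto simp: in_keys_iff lookup_scale)
  then show ?case using step assms(2)[of x] keys_add[of "c \<star> x" y] by blast
qed simp

lemma keys_mult_mono:
  "keys (word_mono u * p * word_mono v) \<subseteq> (\<lambda>w. Word (u @ letters w @ v)) ` keys p"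
proof -
  define W where "W = {xs. Word xs \<in> keys p}"
  have "p \<in> fa.span (word_mono ` W)" unfolding W_def by (rule span_word_mono)
  then have "word_mono u * p * word_mono v \<in> fa.span ((\<lambda>xs. word_mono (u @ xs @ v)) ` W)"
  proof (induction rule: fa.span_induct_alt)
    case (step c x y)
    then obtain xs where "xs \<in> W" "x = word_mono xs" by blast
    then have "word_mono u * x * word_mono v \<in> fa.span ((\<lambda>xs. word_mono (u @ xs @ v)) ` W)"
      by (auto simp: word_mono_append intro: fa.span_base)
    with step show ?case
      by (simp add: distrib_left distrib_right scale_mult fa.span_add fa.span_scale)
  qed (simp add: fa.span_zero)
  from keys_in_span[OF this, of "(\<lambda>w. Word (u @ letters w @ v)) ` keys p"] show ?thesis
    by (force simp: W_def)
qed

lemma span_mult_closed: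
  assumes "p \<in> fa.span S" "\<And>s. s \<in> S \<Longrightarrow> a * s * b \<in> fa.span T"
  shows "a * p * b \<in> fa.span T"
  using assms(1)
proof (induction rule: fa.span_induct_alt)
  case (step c x y)
  then show ?case using assms(2)[of x]
    by (simp add: distrib_left distrib_right scale_mult mult.assoc fa.span_add fa.span_scale)
qed (simp add: fa.span_zero)

subsection \<open>Linear extension\<close>

definition lin_ext :: "('w \<Rightarrow> ('v::monoid_add \<Rightarrow>\<^sub>0 'k::field)) \<Rightarrow> ('w \<Rightarrow>\<^sub>0 'k) \<Rightarrow> ('v \<Rightarrow>\<^sub>0 'k)"
  where "lin_ext f p = (\<Sum>w\<in>keys p. lookup p w \<star> f w)"

lemma lin_ext_superset:
  assumes "finite A" "keys p \<subseteq> A"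
  shows "lin_ext f p = (\<Sum>w\<in>A. lookup p w \<star> f w)"
  unfolding lin_ext_def using assms
  by (intro sum.mono_neutral_left) (auto simp: in_keys_iff)

lemma lin_ext_add: "lin_ext f (p + q) = lin_ext f p + lin_ext f q"
proof -
  have *: "finite (keys p \<union> keys q)" by simp
  show ?thesis
    unfolding lin_ext_superset[OF * keys_add] lin_ext_superset[OF * Un_upper1] lin_ext_superset[OF * Un_upper2]
    by (simp add: lookup_add fa.scale_left_distrib sum.distrib)
qed

lemma lin_ext_zero [simp]: "lin_ext f 0 = 0"
  by (simp add: lin_ext_def)

lemma lin_ext_single: "lin_ext f (single w c) = c \<star> f w"
  by (simp add: lin_ext_def)

lemma lin_ext_scale: "lin_ext f (c \<star> p) = c \<star> lin_ext f p"
  by (induction p rule: poly_mapping_single_induct)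
   (simp_all add: fa.scale_right_distrib lin_ext_add scale_single lin_ext_single)

lemma lin_ext_diff: "lin_ext f (p - q) = lin_ext f p - lin_ext f q"
  by (metis add_diff_cancel diff_add_cancel lin_ext_add)

lemma lin_ext_word_mono [simp]: "lin_ext f (word_mono xs) = f (Word xs)"
  by (simp add: word_mono_def lin_ext_single)

lemma lin_ext_mult:
  assumes "\<And>u v. f (u + v) = f u * f v"
  shows "lin_ext f (p * q) = lin_ext f p * lin_ext f q"
proof (induction p rule: poly_mapping_single_induct)
  case (add w c p)
  have "lin_ext f (single w c * q) = lin_ext f (single w c) * lin_ext f q"
    by (induction q rule: poly_mapping_single_induct)
      (simp_all add: distrib_left lin_ext_add mult_single lin_ext_single assms scale_mult)
  with add show ?case by (simp add: distrib_right lin_ext_add)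
qed simp

subsection \<open>Homogeneous components\<close>

definition homcomp :: "nat \<Rightarrow> ('l word \<Rightarrow>\<^sub>0 'k::field) \<Rightarrow> ('l word \<Rightarrow>\<^sub>0 'k)"
  where "homcomp n = lin_ext (\<lambda>w. if length (letters w) = n then word_mono (letters w) else 0)"

lemma lookup_homcomp: "lookup (homcomp n p) w = (if length (letters w) = n then lookup p w else 0)"
  by (induction p rule: poly_mapping_single_induct)
    (auto simp: homcomp_def lin_ext_add lookup_add lin_ext_single lookup_scale lookup_word_mono lookup_single when_def)

lemma homcomp_zero [simp]: "homcomp n 0 = 0"
  and homcomp_add: "homcomp n (p + q) = homcomp n p + homcomp n q"
  and homcomp_diff: "homcomp n (p - q) = homcomp n p - homcomp n q"
  and homcomp_scale: "homcomp n (c \<star> p) = c \<star> homcomp n p"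
  by (simp_all add: homcomp_def lin_ext_add lin_ext_diff lin_ext_scale)

lemma homcomp_word_mono: "homcomp n (word_mono xs) = (if length xs = n then word_mono xs else 0)"
  by (simp add: homcomp_def)

lemma homcomp_homcomp: "homcomp n (homcomp m p) = (if n = m then homcomp n p else 0)"
  by (intro poly_mapping_eqI) (auto simp: lookup_homcomp)

text \<open>
  The strict bound makes every step of the filtration by word length an instance, the zero step
  below the degree \<open>0\<close> included.
\<close>
definition words_less :: "nat \<Rightarrow> ('l word \<Rightarrow>\<^sub>0 'k::field) set"
  where "words_less n = {p. \<forall>w\<in>keys p. length (letters w) < n}"

lemma subspace_words_less: "fa.subspace (words_less n)"
  unfolding words_less_def
  by (rule fa.subspaceI; auto simp: lookup_add lookup_scale in_keys_iff)

lemma words_less_mono: "m \<le> n \<Longrightarrow> words_less m \<subseteq> words_less n"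
  by (force simp: words_less_def)

text \<open>
  If one of two factors is changed below its degree, then the product changes below the sum of the
  degrees.  This and the mirrored rule make the product of symbols well defined.
\<close>
lemma words_less_mult:
  assumes "p \<in> words_less (Suc m)" "q \<in> words_less n"
  shows "p * q \<in> words_less (m + n)"
  unfolding words_less_def using assms keys_mult[of p q]
  by (force simp: words_less_def plus_word_def)

lemma words_less_mult':
  assumes "p \<in> words_less m" "q \<in> words_less (Suc n)"
  shows "p * q \<in> words_less (m + n)"
  unfolding words_less_def using assms keys_mult[of p q]
  by (force simp: words_less_def plus_word_def)

lemma homcomp_words_less: "homcomp n p \<in> words_less (Suc n)"
  by (auto simp: words_less_def in_keys_iff lookup_homcomp split: if_splits)

lemma homcomp_of_words_less: "p \<in> words_less n \<Longrightarrow> homcomp n p = 0"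
  by (intro poly_mapping_eqI) (auto simp: lookup_homcomp words_less_def in_keys_iff)

lemma sum_homcomp:
  assumes "p \<in> words_less n" "finite A" "{..<n} \<subseteq> A"
  shows "(\<Sum>i\<in>A. homcomp i p) = p"
  using assms by (intro poly_mapping_eqI) (auto simp: lookup_sum lookup_homcomp words_less_def in_keys_iff)

lemma ex_words_less: "\<exists>n. p \<in> words_less n"
proof -
  have "finite ((\<lambda>w. length (letters w)) ` keys p)" by simp
  then obtain n where "\<forall>k\<in>(\<lambda>w. length (letters w)) ` keys p. k < n"
    by (meson finite_nat_set_iff_bounded)
  then show ?thesis by (auto simp: words_less_def)
qed

lemma homcomp_mult: "homcomp n (p * q) = (\<Sum>i\<le>n. homcomp i p * homcomp (n - i) q)"
  for p q :: "'l word \<Rightarrow>\<^sub>0 'k::field"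
proof (induction p rule: poly_mapping_single_induct)
  case (add w c p)
  define xs where "xs = letters w"
  have "homcomp n (word_mono xs * q) = (\<Sum>i\<le>n. homcomp i (word_mono xs) * homcomp (n - i) q)"
  proof (induction q rule: poly_mapping_single_induct)
    case (add v d q)
    have "homcomp n (word_mono xs * word_mono ys) =
        (\<Sum>i\<le>n. homcomp i (word_mono xs) * homcomp (n - i) (word_mono ys) :: 'l word \<Rightarrow>\<^sub>0 'k)"
      for ys
    proof -
      have "(\<Sum>i\<le>n. homcomp i (word_mono xs) * homcomp (n - i) (word_mono ys) :: 'l word \<Rightarrow>\<^sub>0 'k) =
          (\<Sum>i\<le>n. if i = length xs then
            (if length ys = n - length xs then word_mono (xs @ ys) else (0 :: 'l word \<Rightarrow>\<^sub>0 'k)) else 0)"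
        by (rule sum.cong) (simp_all add: homcomp_word_mono word_mono_append)
      also have "\<dots> = homcomp n (word_mono xs * word_mono ys)"
        by (auto simp: homcomp_word_mono word_mono_append)
      finally show ?thesis by simp
    qed
    with add show ?case
      by (simp add: homcomp_add distrib_left single_eq_scale[of v d] scale_mult homcomp_scale fa.scale_sum_right sum.distrib)
  qed simp
  with add show ?case
    by (simp add: homcomp_add distrib_right single_eq_scale[of w c] scale_mult homcomp_scale fa.scale_sum_right sum.distrib xs_def)
qed simp

section \<open>A linear form of the diamond lemma\<close>

text \<open>
  The relation \<open>g i\<close> has leading word \<open>lead i\<close> with coefficient \<open>1\<close>.  The diamond lemma is stated
  below for the span of the relations instead of for reduction sequences: no normal forms and no
  choice of reductions are involved.
\<close>
locale leading_words =
  fixes R :: "('l word \<times> 'l word) set" and I :: "'i set"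
    and g :: "'i \<Rightarrow> ('l word \<Rightarrow>\<^sub>0 'k::field)" and lead :: "'i \<Rightarrow> 'l word"
  assumes wf_R: "wf R" and trans_R: "trans R" and total_R: "total R"
    and lookup_lead: "i \<in> I \<Longrightarrow> lookup (g i) (lead i) = 1"
    and keys_below: "i \<in> I \<Longrightarrow> w \<in> keys (g i) \<Longrightarrow> w \<noteq> lead i \<Longrightarrow> (w, lead i) \<in> R"
begin

definition below :: "'l word \<Rightarrow> ('l word \<Rightarrow>\<^sub>0 'k) set"
  where "below w = fa.span {g i |i. i \<in> I \<and> (lead i, w) \<in> R}"

definition upto :: "'l word \<Rightarrow> ('l word \<Rightarrow>\<^sub>0 'k) set"
  where "upto w = fa.span {g i |i. i \<in> I \<and> (lead i, w) \<in> R\<^sup>=}"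

lemma upto_mono: "(v, w) \<in> R\<^sup>= \<Longrightarrow> upto v \<subseteq> upto w"
  unfolding upto_def using trans_R by (intro fa.span_mono) (auto dest: transD)

lemma keys_of_below: "p \<in> below w \<Longrightarrow> v \<in> keys p \<Longrightarrow> (v, w) \<in> R"
  unfolding below_def
  by (drule keys_in_span[where W = "{v. (v, w) \<in> R}"]) (auto dest: transD[OF trans_R] keys_below)

text \<open>
  Only finitely many relations occur in a combination, and one of their leading words is largest.
\<close>
lemma upto_if_generated:
  assumes "p \<in> fa.span {g i |i. i \<in> I \<and> P i}" "p \<noteq> 0"
  shows "\<exists>i\<in>I. P i \<and> p \<in> upto (lead i)"
proof -
  have "p = 0 \<or> (\<exists>i\<in>I. P i \<and> p \<in> upto (lead i))"
    using assms(1)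
  proof (induction rule: fa.span_induct_alt)
    case (step c x p)
    then obtain i where i: "i \<in> I" "P i" "x = g i" by blast
    then have gi: "g i \<in> upto (lead i)" by (auto simp: upto_def intro: fa.span_base)
    show ?case
    proof (cases "p = 0")
      case True
      with i gi show ?thesis by (auto simp: upto_def intro: fa.span_scale)
    next
      case False
      with step obtain j where j: "j \<in> I" "P j" "p \<in> upto (lead j)" by blast
      consider "(lead i, lead j) \<in> R\<^sup>=" | "(lead j, lead i) \<in> R\<^sup>=" using total_R by (auto simp: total_on_def)
      then show ?thesis
      proof cases
        case 1
        with gi upto_mono have "g i \<in> upto (lead j)" by blast
        with i j show ?thesis by (auto simp: upto_def intro: fa.span_scale fa.span_add)
      next
        case 2
        with j upto_mono have "p \<in> upto (lead i)" by blast
        with i gi show ?thesis by (auto simp: upto_def intro: fa.span_scale fa.span_add)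
      qed
    qed
  qed simp
  with assms(2) show ?thesis by blast
qed

text \<open>
  Relations with the same leading word agree up to smaller ones, so a single one of them represents
  all of these.
\<close>
lemma upto_decompose:
  assumes conf: "\<And>j. j \<in> I \<Longrightarrow> lead j = lead i \<Longrightarrow> g j - g i \<in> below (lead i)"
    and "p \<in> upto (lead i)" and i: "i \<in> I"
  shows "\<exists>c. p - c \<star> g i \<in> below (lead i)"
  using assms(2) unfolding upto_def
proof (induction rule: fa.span_induct_alt)
  case base
  show ?case by (rule exI[of _ 0]) (simp add: below_def fa.span_zero)
next
  case (step c x p)
  then obtain j where j: "j \<in> I" "(lead j, lead i) \<in> R\<^sup>=" "x = g j" by blast
  from step obtain d where d: "p - d \<star> g i \<in> below (lead i)" by blast
  show ?case
  proof (cases "lead j = lead i")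
    case True
    from conf[OF j(1) True] have "c \<star> (g j - g i) + (p - d \<star> g i) \<in> below (lead i)"
      using d unfolding below_def by (intro fa.span_add fa.span_scale)
    also have "c \<star> (g j - g i) + (p - d \<star> g i) = c \<star> x + p - (c + d) \<star> g i"
      by (simp add: j fa.scale_right_diff_distrib fa.scale_left_distrib)
    finally show ?thesis by blast
  next
    case False
    with j have "g j \<in> below (lead i)" by (auto simp: below_def intro: fa.span_base)
    then have "c \<star> x + (p - d \<star> g i) \<in> below (lead i)"
      using d j unfolding below_def by (intro fa.span_add fa.span_scale) auto
    then show ?thesis by (auto simp: algebra_simps intro: exI[of _ d])
  qed
qed

text \<open>
  Let \<open>w\<close> bound the leading words in a combination that equals \<open>p\<close>.  Up to smaller relations,
  \<open>p = c g\<close> for one relation \<open>g\<close> with leading word \<open>w\<close>.  If \<open>c\<close> is not zero, then nothing cancels \<open>w\<close>,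
  and it occurs in \<open>p\<close>; otherwise the bound \<open>w\<close> can be lowered.
\<close>
theorem reduction_controlled_by_keys:
  assumes conf: "\<And>i j. i \<in> I \<Longrightarrow> j \<in> I \<Longrightarrow> lead j = lead i \<Longrightarrow> g j - g i \<in> below (lead i)"
    and "p \<in> fa.span (g ` I)"
  shows "p \<in> fa.span {g i |i. i \<in> I \<and> (\<exists>v\<in>keys p. (lead i, v) \<in> R\<^sup>=)}"
proof -
  have *: "p \<in> fa.span {g i |i. i \<in> I \<and> (\<exists>v\<in>keys p. (lead i, v) \<in> R\<^sup>=)}" if "p \<in> upto w" for w
    using wf_R that
  proof (induction w rule: wf_induct_rule)
    case (less w)
    show ?case
    proof (cases "p \<in> below w")
      case True
      show ?thesis
      proof (cases "p = 0")
        case False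
        from upto_if_generated[OF True[unfolded below_def] False] less.IH show ?thesis by blast
      qed (simp add: fa.span_zero)
    next
      case False
      have "\<exists>i\<in>I. lead i = w"
      proof (rule ccontr)
        assume "\<not> ?thesis"
        then have "upto w \<subseteq> below w"
          unfolding upto_def below_def by (intro fa.span_mono) auto
        with less.prems False show False by blast
      qed
      then obtain i where i: "i \<in> I" "lead i = w" by blast
      with upto_decompose[OF conf, of i p] less.prems obtain c where c: "p - c \<star> g i \<in> below w" by auto
      with False have "c \<noteq> 0" by auto
      have "w \<notin> keys (p - c \<star> g i)"
        using keys_of_below[OF c, of w] wf_R by (auto simp: wf_irrefl)
      then have "lookup p w = c * lookup (g i) w"
        by (simp add: in_keys_iff lookup_minus lookup_scale)
      with lookup_lead[OF i(1)] i(2) \<open>c \<noteq> 0\<close> have "w \<in> keys p" by (simp add: in_keys_iff)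
      then have "upto w \<subseteq> fa.span {g i |i. i \<in> I \<and> (\<exists>v\<in>keys p. (lead i, v) \<in> R\<^sup>=)}"
        unfolding upto_def by (intro fa.span_mono) blast
      with less.prems show ?thesis by blast
    qed
  qed
  show ?thesis
  proof (cases "p = 0")
    case False
    have "g ` I = {g i |i. i \<in> I \<and> True}" by auto
    with assms(2) have "p \<in> fa.span {g i |i. i \<in> I \<and> True}" by simp
    from upto_if_generated[OF this False] * show ?thesis by blast
  qed (simp add: fa.span_zero)
qed

end

section \<open>Rewriting rules from an adapted basis\<close>

text \<open>
  \<open>B1\<close>, \<open>K\<close> and \<open>B\<close> are bases of \<open>L1\<close>, of \<open>Ker D\<close> and of \<open>L\<close>.  The map \<open>\<beta>\<close> writes a vector in the
  letters of \<open>B\<close>; it is linear, so that calculations with \<open>\<beta>\<close> take place in the tensor algebra.  By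
  \<open>kernel_first\<close> the twisted term \<open>b' a'\<close> is smaller than \<open>a b\<close>.
\<close>
locale adapted_basis = lie_superalgebra scale D br L0 L1 Q
  for scale :: "'k::field \<Rightarrow> 'l::ab_group_add \<Rightarrow> 'l" and D :: "'l \<Rightarrow> 'l"
    and br :: "'l \<Rightarrow> 'l \<Rightarrow> 'l" and L0 L1 :: "'l set" and Q :: "'l \<Rightarrow> 'l" +
  fixes B K B1 :: "'l set" and r :: "('l \<times> 'l) set" and \<beta> :: "'l \<Rightarrow> ('l word \<Rightarrow>\<^sub>0 'k)"
  assumes B1_subset: "B1 \<subseteq> K" and K_subset: "K \<subseteq> B"
    and span_B1: "span B1 = L1" and span_K: "span K = {x. D x = 0}" and span_B: "span B = UNIV"
    and wf_r: "wf r" and trans_r: "trans r" and total_r: "total r"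
    and kernel_first: "D x = 0 \<Longrightarrow> D y \<noteq> 0 \<Longrightarrow> (x, y) \<in> r"
    and linear_beta: "Vector_Spaces.linear scale scalar_mult \<beta>"
    and beta_basis: "b \<in> B \<Longrightarrow> \<beta> b = word_mono [b]"
begin

lemma two_zero: "(2 :: 'k) = 0"
  using of_nat_CHAR[where 'a='k] by (simp add: char_two)

lemma add_self [simp]: "(x :: 'l) + x = 0"
proof -
  have "x + x = scale (1 + 1) x" by (simp only: scale_left_distrib scale_one)
  then show ?thesis by (simp add: two_zero)
qed

lemma add_self_left [simp]: "(x :: 'l) + (x + y) = y"
  by (simp add: add.assoc[symmetric])

lemma fa_add_self [simp]: "(p :: 'l word \<Rightarrow>\<^sub>0 'k) + p = 0"
proof -
  have "p + p = (1 + 1) \<star> p" by (simp only: fa.scale_left_distrib fa.scale_one)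
  then show ?thesis by (simp add: two_zero)
qed

lemma fa_add_self_left [simp]: "(p :: 'l word \<Rightarrow>\<^sub>0 'k) + (p + q) = q"
  by (simp add: add.assoc[symmetric])

lemma fa_minus: "- (p :: 'l word \<Rightarrow>\<^sub>0 'k) = p"
  using fa_add_self neg_eq_iff_add_eq_0 by blast

lemma fa_diff: "(p :: 'l word \<Rightarrow>\<^sub>0 'k) - q = p + q"
  by (metis fa_minus diff_conv_add_uminus)

lemma D_add: "D (x + y) = D x + D y" and D_scale: "D (scale c x) = scale c (D x)"
  and br_add_left: "br (x + y) z = br x z + br y z" and br_scale_left: "br (scale c x) z = scale c (br x z)"
  and br_add_right: "br z (x + y) = br z x + br z y" and br_scale_right: "br z (scale c x) = scale c (br z x)"
  and beta_add: "\<beta> (x + y) = \<beta> x + \<beta> y" and beta_scale: "\<beta> (scale c x) = c \<star> \<beta> x"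
  using linear_D linear_br_left linear_br_right linear_beta by (auto simp: Vector_Spaces.linear_iff)

lemma D_zero [simp]: "D 0 = 0" and br_zero_left [simp]: "br 0 z = 0" and br_zero_right [simp]: "br z 0 = 0"
  and beta_zero [simp]: "\<beta> 0 = 0"
  using D_scale[of 0 0] br_scale_left[of 0 0 z] br_scale_right[of z 0 0] beta_scale[of 0 0] by simp_all

lemmas D_square [simp] = D_square

text \<open>
  The relations carry only plus signs because the characteristic is \<open>2\<close>.
\<close>
definition comm_rel :: "'l \<Rightarrow> 'l \<Rightarrow> 'l word \<Rightarrow>\<^sub>0 'k"
  where "comm_rel x y = \<beta> x * \<beta> y + \<beta> y * \<beta> x + \<beta> (D y) * \<beta> (D x) + \<beta> (br x y)"

definition square_rel :: "'l \<Rightarrow> 'l word \<Rightarrow>\<^sub>0 'k"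
  where "square_rel y = \<beta> y * \<beta> y + \<beta> (Q y)"

lemma Q_scale: "y \<in> L1 \<Longrightarrow> Q (scale c y) = scale (c ^ 2) (Q y)"
  and Q_in_L0: "y \<in> L1 \<Longrightarrow> Q y \<in> L0"
  using quadratic_Q by (auto simp: quadratic_map_on_def)

lemma Q_add: "x \<in> L1 \<Longrightarrow> y \<in> L1 \<Longrightarrow> Q (x + y) = Q x + Q y + br x y"
  using Q_polar[of x y] by (simp add: algebra_simps)

lemma D_L1: "y \<in> L1 \<Longrightarrow> D y = 0" and D_L0: "x \<in> L0 \<Longrightarrow> D x = 0"
  and D_in_L1: "D x \<in> L1"
  using L1_kernel L0_kernel image_D_L1 by auto

lemma comm_rel_add_left: "comm_rel (x + y) z = comm_rel x z + comm_rel y z"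
  and comm_rel_add_right: "comm_rel z (x + y) = comm_rel z x + comm_rel z y"
  and comm_rel_scale_left: "comm_rel (scale c x) z = c \<star> comm_rel x z"
  and comm_rel_scale_right: "comm_rel z (scale c x) = c \<star> comm_rel z x"
  by (simp_all add: comm_rel_def beta_add D_add br_add_left br_add_right beta_scale D_scale br_scale_left
      br_scale_right scale_mult distrib_left distrib_right fa.scale_right_distrib add.assoc
      add.commute add.left_commute)

lemma comm_rel_zero [simp]: "comm_rel 0 y = 0" "comm_rel x 0 = 0"
  by (simp_all add: comm_rel_def)

text \<open>
  The commutation relation of a vector with itself is not empty: it says \<open>x' x' = [x, x]\<close>, which is
  the square relation at \<open>x'\<close> as \<open>Q(x') = [x, x]\<close>.
\<close>
lemma comm_rel_self: "comm_rel x x = square_rel (D x)"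
  by (simp add: comm_rel_def square_rel_def Q_D)

lemma square_rel_zero [simp]: "square_rel 0 = 0"
  using comm_rel_self[of 0] by simp

text \<open>
  Exchanging the arguments twists the bracket in the same way as the braiding twists the product.
\<close>
lemma comm_rel_swap: "comm_rel x y = comm_rel y x + comm_rel (D y) (D x)"
proof -
  have "\<beta> (br x y) = \<beta> (br y x) + \<beta> (br (D y) (D x))"
    by (metis br_commute beta_add)
  then show ?thesis by (simp add: comm_rel_def ac_simps)
qed

lemma square_rel_add:
  "x \<in> L1 \<Longrightarrow> y \<in> L1 \<Longrightarrow> square_rel (x + y) = square_rel x + square_rel y + comm_rel x y"
  by (simp add: square_rel_def comm_rel_def Q_add beta_add distrib_left distrib_right D_L1 ac_simps)

lemma square_rel_scale: "y \<in> L1 \<Longrightarrow> square_rel (scale c y) = (c ^ 2) \<star> square_rel y"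
  by (simp add: square_rel_def Q_scale beta_scale scale_mult fa.scale_right_distrib power2_eq_square)

lemma comm_rel_bilinear_mem:
  assumes S: "fa.subspace S" and "\<And>i j. i \<in> A \<Longrightarrow> j \<in> A' \<Longrightarrow> comm_rel i j \<in> S"
    and "x \<in> span A" "y \<in> span A'"
  shows "comm_rel x y \<in> S"
  using assms(3)
proof (induction rule: span_induct_alt)
  case (step c i x)
  have "comm_rel i y \<in> S"
    using assms(4)
    by (induction rule: span_induct_alt)
      (use S assms(2) step(1) in \<open>auto simp: comm_rel_add_right comm_rel_scale_right
        intro!: fa.subspace_0 fa.subspace_add fa.subspace_scale\<close>)
  with step S show ?case
    by (simp add: comm_rel_add_left comm_rel_scale_left fa.subspace_add fa.subspace_scale)
qed (use S in \<open>simp add: fa.subspace_0\<close>)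

lemma beta_span:
  assumes "A \<subseteq> B" "x \<in> span A"
  shows "\<beta> x \<in> fa.span (word_mono ` (\<lambda>a. [a]) ` A)"
  using assms(2)
proof (induction rule: span_induct_alt)
  case (step c a x)
  then have "\<beta> a \<in> fa.span (word_mono ` (\<lambda>a. [a]) ` A)"
    using assms(1) by (auto simp: beta_basis subset_iff intro!: fa.span_base)
  with step show ?case
    by (simp add: beta_add beta_scale fa.span_add fa.span_scale)
qed (simp add: fa.span_zero)

lemma keys_beta: "A \<subseteq> B \<Longrightarrow> x \<in> span A \<Longrightarrow> keys (\<beta> x) \<subseteq> (\<lambda>a. Word [a]) ` A"
  by (rule keys_in_span[OF beta_span]) auto

definition word_order :: "('l word \<times> 'l word) set"
  where "word_order = {(u, v). (letters u, letters v) \<in> lenlex r}"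

lemma r_irrefl: "(x, x) \<notin> r"
  using wf_r by (simp add: wf_irrefl)

lemma word_order_Word [simp]: "(Word u, Word v) \<in> word_order \<longleftrightarrow> (u, v) \<in> lenlex r"
  by (simp add: word_order_def)

lemma wf_word_order: "wf word_order" and trans_word_order: "trans word_order"
  and total_word_order: "total word_order"
proof -
  have eq: "word_order = inv_image (lenlex r) letters"
    by (auto simp: word_order_def inv_image_def)
  show "wf word_order" "trans word_order"
    unfolding eq using wf_r trans_r by (auto intro: trans_inv_image)
  have "total (lenlex r)" using total_r by (rule total_lenlex)
  then show "total word_order"
    unfolding total_on_def word_order_def by (simp, metis word.expand)
qed

lemma lenlex_context: "(x, y) \<in> lenlex r \<Longrightarrow> (u @ x @ v, u @ y @ v) \<in> lenlex r"
  using r_irrefl by (simp add: lenlex_append1 irrefl_def)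

definition rule_rel :: "'l \<Rightarrow> 'l \<Rightarrow> 'l word \<Rightarrow>\<^sub>0 'k"
  where "rule_rel a b = (if a = b then square_rel a else comm_rel a b)"

definition leading_pairs :: "('l \<times> 'l) set"
  where "leading_pairs = {(a, b). a \<in> B \<and> b \<in> B \<and> (b, a) \<in> r} \<union> {(c, c) |c. c \<in> B1}"

definition tail :: "'l \<Rightarrow> 'l \<Rightarrow> 'l word \<Rightarrow>\<^sub>0 'k"
  where "tail a b = rule_rel a b + word_mono [a, b]"

lemma rule_rel_eq: "rule_rel a b = word_mono [a, b] + tail a b"
  by (simp add: tail_def add.left_commute)

lemma leading_pairs_B: "(a, b) \<in> leading_pairs \<Longrightarrow> a \<in> B \<and> b \<in> B"
  using B1_subset K_subset by (auto simp: leading_pairs_def)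

lemma D_in_span_K: "D x \<in> span K"
  by (simp add: span_K)

text \<open>
  Besides \<open>b a\<close>, the words of length two come from \<open>b' a'\<close>.  They occur only if \<open>a\<close> lies outside
  \<open>Ker D\<close>, and then their first letter lies in \<open>Ker D\<close> and precedes \<open>a\<close>.
\<close>
lemma keys_tail:
  assumes "(a, b) \<in> leading_pairs"
  shows "keys (tail a b) \<subseteq> {w. (w, Word [a, b]) \<in> word_order}"
proof -
  have linear: "keys (\<beta> x) \<subseteq> {w. (w, Word [a, b]) \<in> word_order}" for x
    using keys_beta[of B x] span_B by (auto simp: Cons_lenlex_iff)
  have add: "keys (p + q) \<subseteq> W" if "keys p \<subseteq> W" "keys q \<subseteq> W" for p q :: "'l word \<Rightarrow>\<^sub>0 'k" and W
    using that keys_add[of p q] by blast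
  show ?thesis
  proof (cases "a = b")
    case True
    then have "tail a b = \<beta> (Q a)" using leading_pairs_B[OF assms]
      by (simp add: tail_def rule_rel_def square_rel_def beta_basis word_mono_append ac_simps)
    with linear show ?thesis by simp
  next
    case False
    then have ab: "a \<in> B" "b \<in> B" "(b, a) \<in> r" using assms by (auto simp: leading_pairs_def)
    have "tail a b = word_mono [b, a] + \<beta> (D b) * \<beta> (D a) + \<beta> (br a b)"
      using False ab by (simp add: tail_def rule_rel_def comm_rel_def beta_basis word_mono_append ac_simps)
    moreover have "keys (word_mono [b, a] :: 'l word \<Rightarrow>\<^sub>0 'k) \<subseteq> {w. (w, Word [a, b]) \<in> word_order}"
      using ab by (simp add: Cons_lenlex_iff)
    moreover have "keys (\<beta> (D b) * \<beta> (D a)) \<subseteq> {w. (w, Word [a, b]) \<in> word_order}"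
    proof (cases "D a = 0")
      case False
      have "(k, a) \<in> r" if "k \<in> K" for k
        using that False span_K span_base[of k K] by (auto intro: kernel_first)
      then show ?thesis
        using keys_mult[of "\<beta> (D b)" "\<beta> (D a)"] keys_beta[OF K_subset D_in_span_K, of b]
          keys_beta[OF K_subset D_in_span_K, of a]
        by (fastforce simp: plus_word_def Cons_lenlex_iff)
    qed simp
    ultimately show ?thesis using linear[of "br a b"] by (simp only: add)
  qed
qed

definition rewritings :: "('l list \<times> 'l \<times> 'l \<times> 'l list) set"
  where "rewritings = {(u, a, b, v). (a, b) \<in> leading_pairs}"

fun lead_word :: "'l list \<times> 'l \<times> 'l \<times> 'l list \<Rightarrow> 'l word"
  where "lead_word (u, a, b, v) = Word (u @ [a, b] @ v)"

fun rewriting_rel :: "'l list \<times> 'l \<times> 'l \<times> 'l list \<Rightarrow> 'l word \<Rightarrow>\<^sub>0 'k"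
  where "rewriting_rel (u, a, b, v) = word_mono u * rule_rel a b * word_mono v"

lemma rewriting_rel_eq:
  "rewriting_rel (u, a, b, v) = word_mono (u @ [a, b] @ v) + word_mono u * tail a b * word_mono v"
  by (simp add: rule_rel_eq distrib_left distrib_right word_mono_append)

lemma keys_tail_context:
  assumes "(a, b) \<in> leading_pairs"
  shows "keys (word_mono u * tail a b * word_mono v) \<subseteq> {w. (w, Word (u @ [a, b] @ v)) \<in> word_order}"
proof
  fix w assume "w \<in> keys (word_mono u * tail a b * word_mono v)"
  then obtain w' where "w = Word (u @ letters w' @ v)" "w' \<in> keys (tail a b)"
    using keys_mult_mono by blast
  with keys_tail[OF assms] lenlex_context[of "letters w'" "[a, b]" u v]
  show "w \<in> {w. (w, Word (u @ [a, b] @ v)) \<in> word_order}"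
    by (auto simp: word_order_def)
qed

sublocale rw: leading_words word_order rewritings rewriting_rel lead_word
proof
  fix i assume "i \<in> rewritings"
  then obtain u a b v where i: "i = (u, a, b, v)" and ab: "(a, b) \<in> leading_pairs"
    by (auto simp: rewritings_def)
  note keys = keys_tail_context[OF ab, of u v]
  have "Word (u @ [a, b] @ v) \<notin> keys (word_mono u * tail a b * word_mono v)"
    using keys lenlex_irreflexive[OF r_irrefl] by auto
  then show "lookup (rewriting_rel i) (lead_word i) = 1"
    unfolding i rewriting_rel_eq by (simp add: lookup_add lookup_word_mono in_keys_iff)
  fix w assume "w \<in> keys (rewriting_rel i)" "w \<noteq> lead_word i"
  then show "(w, lead_word i) \<in> word_order"
    using keys keys_add[of "word_mono (u @ [a, b] @ v)" "word_mono u * tail a b * word_mono v"]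
    unfolding i rewriting_rel_eq lead_word.simps by auto
qed (rule wf_word_order trans_word_order total_word_order)+

section \<open>Confluence\<close>

lemma subspace_context:
  "fa.subspace {p. word_mono u * p * word_mono v \<in> rw.below w}"
  unfolding rw.below_def
  by (rule fa.subspaceI)
    (auto simp: distrib_left distrib_right scale_mult fa.span_zero fa.span_add fa.span_scale)

lemma rule_rel_below:
  assumes "(a, b) \<in> leading_pairs" "(Word (u @ [a, b] @ v), w) \<in> word_order"
  shows "word_mono u * rule_rel a b * word_mono v \<in> rw.below w"
proof -
  have "(u, a, b, v) \<in> rewritings" using assms(1) by (simp add: rewritings_def)
  with assms(2) show ?thesis
    unfolding rw.below_def by (intro fa.span_base) (auto intro!: exI[of _ "(u, a, b, v)"])
qed

lemma comm_rel_kernel_below: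
  assumes "a \<in> K" "b \<in> K"
    and w: "(Word (u @ [a, b] @ v), w) \<in> word_order" "(Word (u @ [b, a] @ v), w) \<in> word_order"
  shows "word_mono u * comm_rel a b * word_mono v \<in> rw.below w"
proof -
  have D: "D a = 0" "D b = 0" using assms span_K span_base by blast+
  consider "a = b" | "(b, a) \<in> r" "a \<noteq> b" | "(a, b) \<in> r" "a \<noteq> b"
    using total_r by (auto simp: total_on_def)
  then show ?thesis
  proof cases
    case 1
    with D show ?thesis by (simp add: comm_rel_self rw.below_def fa.span_zero)
  next
    case 2
    with rule_rel_below[of a b u v w] w assms K_subset show ?thesis by (auto simp: leading_pairs_def rule_rel_def)
  next
    case 3
    with rule_rel_below[of b a u v w] w assms K_subset D show ?thesis
      by (subst comm_rel_swap) (auto simp: leading_pairs_def rule_rel_def)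
  qed
qed

text \<open>
  Expanding a square over \<open>B1\<close> produces the rules \<open>c c \<rightarrow> Q(c)\<close> and, from the mixed terms,
  commutation relations.
\<close>
lemma square_rel_below:
  assumes "y \<in> L1" "\<And>c d. c \<in> B1 \<Longrightarrow> d \<in> B1 \<Longrightarrow> (Word (u @ [c, d] @ v), w) \<in> word_order"
  shows "word_mono u * square_rel y * word_mono v \<in> rw.below w"
proof -
  have "y \<in> span B1" using assms(1) span_B1 by simp
  then have "y \<in> L1 \<and> square_rel y \<in> {p. word_mono u * p * word_mono v \<in> rw.below w}"
  proof (induction rule: span_induct_alt)
    case (step c x y)
    then have L1: "x \<in> L1" "scale c x \<in> L1" "y \<in> L1"
      using span_B1 span_base span_scale by blast+
    have "word_mono u * rule_rel x x * word_mono v \<in> rw.below w"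
      by (rule rule_rel_below) (use step assms in \<open>auto simp: leading_pairs_def\<close>)
    then have x: "square_rel x \<in> {p. word_mono u * p * word_mono v \<in> rw.below w}"
      by (simp add: rule_rel_def)
    have "comm_rel x y \<in> {p. word_mono u * p * word_mono v \<in> rw.below w}"
    proof (rule comm_rel_bilinear_mem[OF subspace_context])
      show "x \<in> span {x}" by (simp add: span_base)
      show "y \<in> span B1" using L1 span_B1 by simp
    qed (use step assms B1_subset in \<open>auto intro!: comm_rel_kernel_below\<close>)
    moreover have "scale c x + y \<in> L1"
      using L1 span_B1 by (metis span_add)
    ultimately show ?case using L1 x step subspace_context[of u v w]
      by (auto simp: square_rel_add square_rel_scale comm_rel_scale_left
        intro!: fa.subspace_add[OF subspace_context, simplified] fa.subspace_scale[OF subspace_context, simplified])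
  qed (use span_B1 span_zero[of B1] in \<open>simp add: rw.below_def fa.span_zero\<close>)
  then show ?thesis by simp
qed

text \<open>
  The rules are the relations with \<open>a > b\<close>.  For \<open>a < b\<close> the relation is the one for \<open>b, a\<close> plus the
  one for the derivatives, and for \<open>a = b\<close> it is the square relation at \<open>a'\<close>.  The derivatives are
  combinations of letters of \<open>Ker D\<close>, which precede every letter with a nonzero derivative.
\<close>
lemma comm_rel_basis_below:
  assumes B: "a \<in> B" "b \<in> B"
    and w: "(Word (u @ [a, b] @ v), w) \<in> word_order" "(Word (u @ [b, a] @ v), w) \<in> word_order"
  shows "word_mono u * comm_rel a b * word_mono v \<in> rw.below w"
proof -
  have smaller: "(Word (u @ [c, d] @ v), w) \<in> word_order"
    if D: "D c = 0" "D a \<noteq> 0 \<or> D b \<noteq> 0" for c d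
  proof -
    obtain x y where xy: "D x \<noteq> 0" "(Word (u @ [x, y] @ v), w) \<in> word_order"
      using D(2) w by (cases "D a = 0") auto
    with D(1) kernel_first have "([c, d], [x, y]) \<in> lenlex r" by (auto simp: Cons_lenlex_iff)
    from lenlex_context[OF this, of u v] xy trans_word_order show ?thesis
      by (meson transD word_order_Word)
  qed
  have derived: "word_mono u * comm_rel (D b) (D a) * word_mono v \<in> rw.below w"
  proof (cases "D a = 0")
    case False
    have "comm_rel (D b) (D a) \<in> {p. word_mono u * p * word_mono v \<in> rw.below w}"
    proof (rule comm_rel_bilinear_mem[OF subspace_context _ D_in_span_K D_in_span_K])
      fix i j assume ij: "i \<in> K" "j \<in> K"
      then have "D i = 0" "D j = 0" using span_K span_base by blast+
      with ij smaller False show "comm_rel i j \<in> {p. word_mono u * p * word_mono v \<in> rw.below w}"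
        by (auto intro!: comm_rel_kernel_below simp del: word_order_Word)
    qed
    then show ?thesis by simp
  qed (simp add: rw.below_def fa.span_zero)
  consider "a = b" | "(b, a) \<in> r" "a \<noteq> b" | "(a, b) \<in> r" "a \<noteq> b"
    using total_r by (auto simp: total_on_def)
  then show ?thesis
  proof cases
    case 1
    show ?thesis
    proof (cases "D a = 0")
      case False
      have "D c = 0" if "c \<in> B1" for c
        using that span_B1 span_base D_L1 by blast
      with smaller False 1 show ?thesis
        by (auto simp: comm_rel_self simp del: word_order_Word intro!: square_rel_below D_in_L1)
    qed (use 1 in \<open>simp add: comm_rel_self rw.below_def fa.span_zero\<close>)
  next
    case 2
    with rule_rel_below[of a b u v w] w B show ?thesis by (auto simp: leading_pairs_def rule_rel_def)
  next
    case 3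
    with rule_rel_below[of b a u v w] w B have "word_mono u * comm_rel b a * word_mono v \<in> rw.below w"
      by (auto simp: leading_pairs_def rule_rel_def)
    with derived show ?thesis
      unfolding rw.below_def
      by (subst comm_rel_swap) (simp add: distrib_left distrib_right fa.span_add)
  qed
qed

text \<open>
  A multiple of a commutation relation lies below \<open>w\<close> if its two words with the undifferentiated
  letters do.  The overlaps are checked with this criterion.
\<close>
lemma comm_rel_below:
  assumes p: "p \<in> fa.span (word_mono ` U)" and q: "q \<in> fa.span (word_mono ` V)"
    and AA: "A \<subseteq> B" "A' \<subseteq> B" and xy: "x \<in> span A" "y \<in> span A'"
    and w: "\<And>u v a b. u \<in> U \<Longrightarrow> v \<in> V \<Longrightarrow> a \<in> A \<Longrightarrow> b \<in> A' \<Longrightarrow>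
      (Word (u @ [a, b] @ v), w) \<in> word_order \<and> (Word (u @ [b, a] @ v), w) \<in> word_order"
  shows "p * comm_rel x y * q \<in> rw.below w"
proof -
  have "word_mono u * comm_rel x y * word_mono v \<in> rw.below w" if "u \<in> U" "v \<in> V" for u v
  proof -
    have "comm_rel x y \<in> {p. word_mono u * p * word_mono v \<in> rw.below w}"
      by (rule comm_rel_bilinear_mem[OF subspace_context _ xy])
        (use that w AA in \<open>auto intro!: comm_rel_basis_below simp del: word_order_Word\<close>)
    then show ?thesis by simp
  qed
  note words = this
  have "word_mono u * comm_rel x y * q \<in> rw.below w" if "u \<in> U" for u
    using span_mult_closed[OF q, of "word_mono u * comm_rel x y" 1] words that
    by (auto simp: rw.below_def)
  then show ?thesis
    using span_mult_closed[OF p, of 1 "comm_rel x y * q"] by (auto simp: rw.below_def mult.assoc)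
qed

text \<open>
  The Jacobi identity at \<open>x', y, z'\<close>: its twisted terms contain second derivatives.
\<close>
lemma jacobi_derived: "br (br (D z) (D x)) y + br (br (D z) y) (D x) + br (br (D x) y) (D z) = 0"
proof -
  have "br y (D z) = br (D z) y" using br_commute[of y "D z"] by simp
  with jacobi[of "D x" y "D z"] show ?thesis by (simp add: ac_simps)
qed

text \<open>
  The difference of the two reductions of \<open>x y z\<close>, reduced further.  The first four summands continue
  both reductions until they reach \<open>z y x\<close>.  The brackets that arise have to be moved past the
  third letter, and so do the twisted terms \<open>y' x'\<close>, \<open>z' x'\<close> and \<open>z' y'\<close>.  The remaining products
  of two letters cancel because \<open>D\<close> is a derivation.  The remaining single letters are the Jacobi
  identity at \<open>x, y, z\<close>, except for the terms that come from writing \<open>[x, z]\<close> for \<open>[z, x]\<close> and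
  \<open>[z', y]\<close> for \<open>[x', y]\<close>; these are \<open>jacobi_derived\<close>.
\<close>
lemma overlap_identity:
  "comm_rel x y * \<beta> z + \<beta> x * comm_rel y z =
    \<beta> y * comm_rel x z + comm_rel x z * \<beta> y + comm_rel y z * \<beta> x + \<beta> z * comm_rel x y
    + comm_rel (br x y) z + comm_rel (br y z) x + comm_rel (br x z) y
    + comm_rel (D y) z * \<beta> (D x) + \<beta> (D y) * comm_rel (D x) z
    + comm_rel (D z) x * \<beta> (D y) + \<beta> (D z) * comm_rel (D y) x
    + comm_rel (D z) y * \<beta> (D x) + \<beta> (D z) * comm_rel (D x) y
    + comm_rel (D x) (br (D y) z) + comm_rel (D x) (br (D z) y) + comm_rel (D y) (br (D z) x)"
proof -
  have swap: "br a (D b) = br (D b) a" for a b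
    using br_commute[of a "D b"] by simp
  have D_br': "D (br a b) = br (D a) b + br (D b) a" for a b
    by (simp add: D_br swap)
  have "br (br x y) z + br (br y z) x + br (br x z) y
      + br (D x) (br (D y) z) + br (D x) (br (D z) y) + br (D y) (br (D z) x)
    = (br (br x y) z + br (br z x) y + br (br y z) x
      + br (br (D x) y) (D z) + br (br (D z) x) (D y) + br (br (D y) z) (D x))
      + (br (br (D z) (D x)) y + br (br (D z) y) (D x) + br (br (D x) y) (D z))"
    using br_commute[of x z] swap[of "br (D y) z" x] swap[of "br (D z) y" x] swap[of "br (D z) x" y]
    by (simp add: br_add_left ac_simps)
  then have "br (br x y) z + br (br y z) x + br (br x z) y
      + br (D x) (br (D y) z) + br (D x) (br (D z) y) + br (D y) (br (D z) x) = 0"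
    by (simp add: jacobi jacobi_derived)
  then have "\<beta> (br (br x y) z + br (br y z) x + br (br x z) y
      + br (D x) (br (D y) z) + br (D x) (br (D z) y) + br (D y) (br (D z) x)) = 0"
    by simp
  then have last: "\<beta> (br (D y) (br (D z) x)) = \<beta> (br (br x y) z) + \<beta> (br (br y z) x) + \<beta> (br (br x z) y)
      + \<beta> (br (D x) (br (D y) z)) + \<beta> (br (D x) (br (D z) y))"
    unfolding beta_add by (metis fa_diff diff_eq_eq eq_diff_eq add_0)
  show ?thesis
    unfolding comm_rel_def distrib_left distrib_right D_br' last
    by (simp add: beta_add distrib_left distrib_right D_br' mult.assoc ac_simps)
qed

lemma comm_rel_below_left:
  assumes "C \<subseteq> B" "A \<subseteq> B" "A' \<subseteq> B" "c \<in> span C" "x \<in> span A" "y \<in> span A'"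
    and "\<And>c a b. c \<in> C \<Longrightarrow> a \<in> A \<Longrightarrow> b \<in> A' \<Longrightarrow> ([c, a, b], w) \<in> lenlex r \<and> ([c, b, a], w) \<in> lenlex r"
  shows "\<beta> c * comm_rel x y \<in> rw.below (Word w)"
proof -
  have "\<beta> c * comm_rel x y * 1 \<in> rw.below (Word w)"
    by (rule comm_rel_below[OF beta_span[OF assms(1,4)] _ assms(2,3,5,6), of _ "{[]}"])
      (use assms(7) in \<open>auto simp: word_mono_Nil fa.span_base\<close>)
  then show ?thesis by simp
qed

lemma comm_rel_below_right:
  assumes "C \<subseteq> B" "A \<subseteq> B" "A' \<subseteq> B" "c \<in> span C" "x \<in> span A" "y \<in> span A'"
    and "\<And>c a b. c \<in> C \<Longrightarrow> a \<in> A \<Longrightarrow> b \<in> A' \<Longrightarrow> ([a, b, c], w) \<in> lenlex r \<and> ([b, a, c], w) \<in> lenlex r"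
  shows "comm_rel x y * \<beta> c \<in> rw.below (Word w)"
proof -
  have "1 * comm_rel x y * \<beta> c \<in> rw.below (Word w)"
    by (rule comm_rel_below[OF _ beta_span[OF assms(1,4)] assms(2,3,5,6), of _ "{[]}"])
      (use assms(7) in \<open>auto simp: word_mono_Nil fa.span_base\<close>)
  then show ?thesis by simp
qed

lemma comm_rel_below_short:
  assumes "2 < length w"
  shows "comm_rel x y \<in> rw.below (Word w)"
  using comm_rel_below[of 1 "{[]}" 1 "{[]}" B B x y "Word w"] assms span_B
  by (auto simp: word_mono_Nil fa.span_base lenlex_conv)

lemma below_add: "p \<in> rw.below w \<Longrightarrow> q \<in> rw.below w \<Longrightarrow> p + q \<in> rw.below w"
  unfolding rw.below_def by (rule fa.span_add)

text \<open>
  In the summands with derivatives, the bound on the words holds since a letter of \<open>a'\<close> precedes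
  \<open>a\<close> when \<open>a'\<close> is not zero.
\<close>
lemma overlap_comm_comm:
  assumes B: "x \<in> B" "y \<in> B" "z \<in> B" and less: "(y, x) \<in> r" "(z, y) \<in> r"
  shows "comm_rel x y * \<beta> z + \<beta> x * comm_rel y z \<in> rw.below (Word [x, y, z])"
proof -
  \<comment> \<open>The letters that can occur in \<open>D a\<close>; none if \<open>D a = 0\<close>, in which case \<open>K\<close> need not precede \<open>a\<close>.\<close>
  define A where "A a = (if D a = 0 then {} else K)" for a
  have D_A: "D a \<in> span (A a)" for a
    by (auto simp: A_def span_zero D_in_span_K)
  have A_B: "A a \<subseteq> B" for a using K_subset by (auto simp: A_def)
  have A_less: "(k, a) \<in> r" if "k \<in> A a" for k a
    using that span_K span_base[of k K] by (auto simp: A_def kernel_first split: if_splits)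
  have less': "(z, x) \<in> r" using less trans_r by (meson transD)
  have A_less': "(k, x) \<in> r" if "k \<in> A y \<or> k \<in> A z" for k
    using that A_less less less' trans_r by (meson transD)
  have A_less'': "(k, y) \<in> r" if "k \<in> A z" for k
    using that A_less less less' trans_r by (meson transD)
  have self: "a \<in> span {a}" for a by (simp add: span_base)
  note facts = less less' A_less A_less' A_less''
  show ?thesis
    unfolding overlap_identity
  proof (intro below_add comm_rel_below_short)
    show "\<beta> y * comm_rel x z \<in> rw.below (Word [x, y, z])"
      by (rule comm_rel_below_left[of "{y}" "{x}" "{z}"]) (use B in \<open>auto simp: Cons_lenlex_iff facts self\<close>)
    show "comm_rel x z * \<beta> y \<in> rw.below (Word [x, y, z])"
      by (rule comm_rel_below_right[of "{y}" "{x}" "{z}"]) (use B in \<open>auto simp: Cons_lenlex_iff facts self\<close>)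
    show "comm_rel y z * \<beta> x \<in> rw.below (Word [x, y, z])"
      by (rule comm_rel_below_right[of "{x}" "{y}" "{z}"]) (use B in \<open>auto simp: Cons_lenlex_iff facts self\<close>)
    show "\<beta> z * comm_rel x y \<in> rw.below (Word [x, y, z])"
      by (rule comm_rel_below_left[of "{z}" "{x}" "{y}"]) (use B in \<open>auto simp: Cons_lenlex_iff facts self\<close>)
    show "comm_rel (D y) z * \<beta> (D x) \<in> rw.below (Word [x, y, z])"
      by (rule comm_rel_below_right[of "A x" "A y" "{z}", OF A_B A_B _ D_A D_A self])
        (use B in \<open>auto simp: Cons_lenlex_iff facts\<close>)
    show "\<beta> (D y) * comm_rel (D x) z \<in> rw.below (Word [x, y, z])"
      by (rule comm_rel_below_left[of "A y" "A x" "{z}", OF A_B A_B _ D_A D_A self])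
        (use B in \<open>auto simp: Cons_lenlex_iff facts\<close>)
    show "comm_rel (D z) x * \<beta> (D y) \<in> rw.below (Word [x, y, z])"
      by (rule comm_rel_below_right[of "A y" "A z" "{x}", OF A_B A_B _ D_A D_A self])
        (use B in \<open>auto simp: Cons_lenlex_iff facts\<close>)
    show "\<beta> (D z) * comm_rel (D y) x \<in> rw.below (Word [x, y, z])"
      by (rule comm_rel_below_left[of "A z" "A y" "{x}", OF A_B A_B _ D_A D_A self])
        (use B in \<open>auto simp: Cons_lenlex_iff facts\<close>)
    show "comm_rel (D z) y * \<beta> (D x) \<in> rw.below (Word [x, y, z])"
      by (rule comm_rel_below_right[of "A x" "A z" "{y}", OF A_B A_B _ D_A D_A self])
        (use B in \<open>auto simp: Cons_lenlex_iff facts\<close>)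
    show "\<beta> (D z) * comm_rel (D x) y \<in> rw.below (Word [x, y, z])"
      by (rule comm_rel_below_left[of "A z" "A x" "{y}", OF A_B A_B _ D_A D_A self])
        (use B in \<open>auto simp: Cons_lenlex_iff facts\<close>)
  qed simp_all
qed

text \<open>
  As \<open>z\<close> precedes a letter of \<open>Ker D\<close>, its derivative vanishes, and the overlap is the one of
  ordinary Lie superalgebras.
\<close>
lemma overlap_square_comm:
  assumes B: "x \<in> B1" "z \<in> B" and less: "(z, x) \<in> r"
  shows "square_rel x * \<beta> z + \<beta> x * comm_rel x z \<in> rw.below (Word [x, x, z])"
proof -
  have x: "x \<in> L1" "D x = 0" "x \<in> B" using B span_B1 span_base B1_subset K_subset D_L1 by blast+
  have z: "D z = 0" using less x kernel_first[of x z] wf_r by (meson wf_asym)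
  have DQ: "D (Q x) = 0" using D_L0 Q_in_L0 x by blast
  have "br x (br x z) = br (Q x) z" using br_Q[OF x(1)] by simp
  then have "square_rel x * \<beta> z + \<beta> x * comm_rel x z =
    comm_rel x z * \<beta> x + \<beta> z * square_rel x + comm_rel (Q x) z + comm_rel x (br x z)"
    by (simp add: comm_rel_def square_rel_def x z DQ D_br distrib_left distrib_right mult.assoc ac_simps)
  moreover have "comm_rel x z * \<beta> x \<in> rw.below (Word [x, x, z])"
    by (rule comm_rel_below_right[of "{x}" "{x}" "{z}"])
      (use B x less in \<open>auto simp: Cons_lenlex_iff span_base\<close>)
  moreover have "\<beta> z * square_rel x \<in> rw.below (Word [x, x, z])"
    using rule_rel_below[of x x "[z]" "[]" "Word [x, x, z]"] B less
    by (auto simp: leading_pairs_def rule_rel_def Cons_lenlex_iff beta_basis word_mono_Nil)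
  ultimately show ?thesis
    by (auto intro!: below_add comm_rel_below_short)
qed

text \<open>
  The letter \<open>x\<close> may have a derivative, but each twisted term also contains the derivative of \<open>y\<close> or
  of \<open>Q(y)\<close>, and these vanish.
\<close>
lemma overlap_comm_square:
  assumes B: "x \<in> B" "y \<in> B1" and less: "(y, x) \<in> r"
  shows "comm_rel x y * \<beta> y + \<beta> x * square_rel y \<in> rw.below (Word [x, y, y])"
proof -
  have y: "y \<in> L1" "D y = 0" "y \<in> B" using B span_B1 span_base B1_subset K_subset D_L1 by blast+
  have DQ: "D (Q y) = 0" using D_L0 Q_in_L0 y by blast
  have "br (br x y) y = br y (br y x)"
    using br_commute[of x y] br_commute[of "br x y" y] y by simp
  moreover have "br x (Q y) = br y (br y x)"
    using br_commute[of x "Q y"] DQ br_Q[OF y(1)] by simp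
  ultimately have "comm_rel x y * \<beta> y + \<beta> x * square_rel y =
    \<beta> y * comm_rel x y + square_rel y * \<beta> x + comm_rel (br x y) y + comm_rel x (Q y)"
    by (simp add: comm_rel_def square_rel_def y DQ distrib_left distrib_right mult.assoc ac_simps)
  moreover have "\<beta> y * comm_rel x y \<in> rw.below (Word [x, y, y])"
    by (rule comm_rel_below_left[of "{y}" "{x}" "{y}"])
      (use B y less in \<open>auto simp: Cons_lenlex_iff span_base\<close>)
  moreover have "square_rel y * \<beta> x \<in> rw.below (Word [x, y, y])"
    using rule_rel_below[of y y "[]" "[x]" "Word [x, y, y]"] B less
    by (auto simp: leading_pairs_def rule_rel_def Cons_lenlex_iff beta_basis word_mono_Nil)
  ultimately show ?thesis
    by (auto intro!: below_add comm_rel_below_short)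
qed

lemma overlap_square_square:
  assumes "x \<in> B1"
  shows "square_rel x * \<beta> x + \<beta> x * square_rel x \<in> rw.below (Word [x, x, x])"
proof -
  have x: "x \<in> L1" "D x = 0" using assms span_B1 span_base D_L1 by blast+
  have "br (Q x) x = 0" using br_Q[OF x(1)] br_self[OF x(2)] by simp
  then have "square_rel x * \<beta> x + \<beta> x * square_rel x = comm_rel (Q x) x"
    using x by (simp add: comm_rel_def square_rel_def distrib_left distrib_right mult.assoc ac_simps)
  then show ?thesis by (simp add: comm_rel_below_short)
qed

lemma overlap_below:
  assumes "(x, y) \<in> leading_pairs" "(y, z) \<in> leading_pairs"
  shows "rule_rel x y * word_mono [z] + word_mono [x] * rule_rel y z \<in> rw.below (Word [x, y, z])"
proof -
  have B: "x \<in> B" "y \<in> B" "z \<in> B" using leading_pairs_B assms by auto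
  then show ?thesis
    using assms overlap_comm_comm[of x y z] overlap_square_comm[of x z] overlap_comm_square[of x y]
      overlap_square_square[of x] r_irrefl
    by (auto simp: leading_pairs_def rule_rel_def beta_basis)
qed

lemma below_context:
  assumes "p \<in> rw.below (Word w)"
  shows "word_mono u * p * word_mono v \<in> rw.below (Word (u @ w @ v))"
  using assms unfolding rw.below_def
proof (rule span_mult_closed)
  fix s assume "s \<in> {rewriting_rel i |i. i \<in> rewritings \<and> (lead_word i, Word w) \<in> word_order}"
  then obtain u' a b v' where s: "s = rewriting_rel (u', a, b, v')" "(a, b) \<in> leading_pairs"
    "(u' @ [a, b] @ v', w) \<in> lenlex r"
    by (auto simp: rewritings_def)
  have "(u @ (u' @ [a, b] @ v') @ v, u @ w @ v) \<in> lenlex r"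
    using s(3) by (rule lenlex_context)
  with s have "(u @ u', a, b, v' @ v) \<in> rewritings"
    "(lead_word (u @ u', a, b, v' @ v), Word (u @ w @ v)) \<in> word_order"
    by (auto simp: rewritings_def)
  moreover have "word_mono u * s * word_mono v = rewriting_rel (u @ u', a, b, v' @ v)"
    by (simp add: s word_mono_append[symmetric] mult.assoc)
  ultimately show "word_mono u * s * word_mono v
      \<in> fa.span {rewriting_rel i |i. i \<in> rewritings \<and> (lead_word i, Word (u @ w @ v)) \<in> word_order}"
    by (intro fa.span_base CollectI exI[of _ "(u @ u', a, b, v' @ v)"] conjI)
qed

text \<open>
  Rules applied at disjoint places commute: replacing both relations by their lower terms in
  either order leaves only smaller multiples of the two.
\<close>
lemma disjoint_below:
  assumes ab: "(a, b) \<in> leading_pairs" and cd: "(c, d) \<in> leading_pairs"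
  shows "rule_rel a b * word_mono (t @ [c, d]) + word_mono ([a, b] @ t) * rule_rel c d
    \<in> rw.below (Word ([a, b] @ t @ [c, d]))"
proof -
  have "rule_rel a b * word_mono (t @ [c, d]) + word_mono ([a, b] @ t) * rule_rel c d =
    rule_rel a b * word_mono t * (word_mono [c, d] + rule_rel c d) +
    (word_mono [a, b] + rule_rel a b) * word_mono t * rule_rel c d"
    by (simp only: word_mono_append[symmetric] distrib_left distrib_right mult.assoc) (simp add: ac_simps)
  also have "\<dots> = rule_rel a b * word_mono t * tail c d + tail a b * word_mono t * rule_rel c d"
    by (simp add: tail_def ac_simps)
  also have "\<dots> \<in> rw.below (Word ([a, b] @ t @ [c, d]))"
  proof (rule below_add)
    have "rule_rel a b * word_mono t * p * 1 \<in> rw.below (Word ([a, b] @ t @ [c, d]))"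
      if p: "p \<in> word_mono ` {xs. Word xs \<in> keys (tail c d)}" for p
    proof -
      obtain xs where xs: "p = word_mono xs" "(xs, [c, d]) \<in> lenlex r"
        using p keys_tail[OF cd] by (auto simp: word_order_def)
      from lenlex_context[OF xs(2), of "[a, b] @ t" "[]"] rule_rel_below[OF ab, of "[]" "t @ xs"]
      show ?thesis by (simp add: xs word_mono_Nil word_mono_append mult.assoc)
    qed
    from span_mult_closed[OF span_word_mono this[unfolded rw.below_def]]
    show "rule_rel a b * word_mono t * tail c d \<in> rw.below (Word ([a, b] @ t @ [c, d]))"
      by (simp add: rw.below_def)
    have "1 * p * (word_mono t * rule_rel c d) \<in> rw.below (Word ([a, b] @ t @ [c, d]))"
      if p: "p \<in> word_mono ` {xs. Word xs \<in> keys (tail a b)}" for p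
    proof -
      obtain xs where xs: "p = word_mono xs" "(xs, [a, b]) \<in> lenlex r"
        using p keys_tail[OF ab] by (auto simp: word_order_def)
      from lenlex_context[OF xs(2), of "[]" "t @ [c, d]"] rule_rel_below[OF cd, of "xs @ t" "[]"]
      show ?thesis by (simp add: xs word_mono_Nil word_mono_append[symmetric] mult.assoc)
    qed
    from span_mult_closed[OF span_word_mono this[unfolded rw.below_def]]
    show "tail a b * word_mono t * rule_rel c d \<in> rw.below (Word ([a, b] @ t @ [c, d]))"
      by (simp add: rw.below_def mult.assoc)
  qed
  finally show ?thesis .
qed

text \<open>
  The second leading word starts \<open>length t\<close> letters after the first: the places agree, overlap in one
  letter, or are disjoint.
\<close>
lemma confluent_shift:
  assumes ab: "(a, b) \<in> leading_pairs" and cd: "(c, d) \<in> leading_pairs" and eq: "[a, b] @ v = t @ [c, d] @ v'"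
  shows "rewriting_rel (u, a, b, v) + rewriting_rel (u @ t, c, d, v') \<in> rw.below (Word (u @ [a, b] @ v))"
proof -
  consider "t = []" | "t = [a]" | s where "t = [a, b] @ s"
  proof (cases t)
    case (Cons x t')
    with eq that show ?thesis by (cases t') auto
  qed (use that in blast)
  then show ?thesis
  proof cases
    case 1
    with eq show ?thesis by (simp add: rw.below_def fa.span_zero)
  next
    case 2
    with eq have t: "b = c" "v = d # v'" by auto
    have "word_mono u * (rule_rel a b * word_mono [d] + word_mono [a] * rule_rel b d) * word_mono v'
        \<in> rw.below (Word (u @ [a, b, d] @ v'))"
      using overlap_below[of a b d] ab cd t by (intro below_context) auto
    also have "word_mono u * (rule_rel a b * word_mono [d] + word_mono [a] * rule_rel b d) * word_mono v'
        = rewriting_rel (u, a, b, v) + rewriting_rel (u @ t, c, d, v')"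
      using word_mono_append[of "[d]" v', where 'b='k] word_mono_append[of u "[a]", where 'b='k]
      by (simp add: 2 t distrib_left distrib_right mult.assoc flip: word_mono_append)
    finally show ?thesis by (simp add: t)
  next
    case 3
    with eq have v: "v = s @ [c, d] @ v'" by simp
    have "word_mono u * (rule_rel a b * word_mono (s @ [c, d]) + word_mono ([a, b] @ s) * rule_rel c d) * word_mono v'
        \<in> rw.below (Word (u @ ([a, b] @ s @ [c, d]) @ v'))"
      by (intro below_context disjoint_below ab cd)
    also have "word_mono u * (rule_rel a b * word_mono (s @ [c, d]) + word_mono ([a, b] @ s) * rule_rel c d) * word_mono v'
        = rewriting_rel (u, a, b, v) + rewriting_rel (u @ t, c, d, v')"
      by (simp only: 3 v rewriting_rel.simps distrib_left distrib_right mult.assoc word_mono_append[symmetric])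
    finally show ?thesis by (simp add: v)
  qed
qed

lemma confluent:
  assumes "i \<in> rewritings" "j \<in> rewritings" and eq: "lead_word j = lead_word i"
  shows "rewriting_rel j - rewriting_rel i \<in> rw.below (lead_word i)"
proof -
  obtain u a b v u' c d v' where i: "i = (u, a, b, v)" "(a, b) \<in> leading_pairs"
    and j: "j = (u', c, d, v')" "(c, d) \<in> leading_pairs"
    using assms by (auto simp: rewritings_def)
  from eq have "u @ [a, b] @ v = u' @ [c, d] @ v'" by (simp add: i j)
  then obtain t where "u' = u @ t \<and> [a, b] @ v = t @ [c, d] @ v' \<or> u = u' @ t \<and> [c, d] @ v' = t @ [a, b] @ v"
    using append_eq_append_conv2[THEN iffD1, of u "[a, b] @ v" u' "[c, d] @ v'"] by metis
  then show ?thesis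
  proof
    assume t: "u' = u @ t \<and> [a, b] @ v = t @ [c, d] @ v'"
    from confluent_shift[OF i(2) j(2), of v t v' u] t show ?thesis
      by (simp add: i j fa_diff add.commute)
  next
    assume t: "u = u' @ t \<and> [c, d] @ v' = t @ [a, b] @ v"
    from confluent_shift[OF j(2) i(2), of v' t v u'] t eq show ?thesis
      by (simp add: i j fa_diff add.commute)
  qed
qed

end

section \<open>Algebras presented by generators and relations\<close>

lemma free_alg_simps [simp]:
  "carrier free_alg = UNIV" "mult free_alg = (*)" "one free_alg = 1" "zero free_alg = 0"
  "add free_alg = (+)" "smult free_alg = (\<star>)"
  by (simp_all add: free_alg_def scalar_mult_def fun_eq_iff)

lemma ring_free_alg: "ring free_alg"
proof (intro ringI abelian_groupI monoidI)
  fix p :: "'l word \<Rightarrow>\<^sub>0 'k::field"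
  show "\<exists>q\<in>carrier free_alg. q \<oplus>\<^bsub>free_alg\<^esub> p = \<zero>\<^bsub>free_alg\<^esub>"
    by (auto intro: exI[of _ "- p"])
qed (simp_all add: ac_simps distrib_left distrib_right mult.assoc)

lemma ring_same_operations:
  assumes "ring R"
  shows "ring \<lparr>carrier = carrier R, mult = mult R, one = one R, zero = zero R, add = add R, smult = f\<rparr>"
proof -
  interpret ring R by fact
  show ?thesis
    by (intro ringI abelian_groupI monoidI)
      (auto simp: a_ac m_assoc l_distr r_distr intro: l_neg)
qed

lemma ideal_free_algI:
  assumes "0 \<in> J" "\<And>p q. p \<in> J \<Longrightarrow> q \<in> J \<Longrightarrow> p + q \<in> J"
    and "\<And>p q. p \<in> J \<Longrightarrow> q * p \<in> J" "\<And>p q. p \<in> J \<Longrightarrow> p * q \<in> J"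
  shows "ideal J free_alg"
proof (rule idealI[OF ring_free_alg])
  have uminus: "- p \<in> J" if "p \<in> J" for p
    using assms(3)[OF that, of "-1"] by simp
  have inv: "inv\<^bsub>add_monoid free_alg\<^esub> p = - p" for p :: "'a word \<Rightarrow>\<^sub>0 'b"
  proof -
    interpret ring "free_alg :: ('b, 'a word \<Rightarrow>\<^sub>0 'b) module" by (rule ring_free_alg)
    show ?thesis
      using minus_equality[of "- p" p] by (simp add: a_inv_def)
  qed
  show "subgroup J (add_monoid free_alg)"
  proof (rule subgroup.intro)
    show "inv\<^bsub>add_monoid free_alg\<^esub> p \<in> J" if "p \<in> J" for p
      using uminus[OF that] by (simp only: inv)
  qed (use assms in auto)
qed (use assms in auto)

lemma ideal_free_algD:
  assumes "ideal J free_alg"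
  shows "0 \<in> J" "p \<in> J \<Longrightarrow> q \<in> J \<Longrightarrow> p + q \<in> J" "p \<in> J \<Longrightarrow> q * p \<in> J" "p \<in> J \<Longrightarrow> p * q \<in> J"
proof -
  interpret ideal J free_alg by fact
  show "0 \<in> J" "p \<in> J \<Longrightarrow> q \<in> J \<Longrightarrow> p + q \<in> J" "p \<in> J \<Longrightarrow> q * p \<in> J" "p \<in> J \<Longrightarrow> p * q \<in> J"
    using additive_subgroup.zero_closed[OF is_additive_subgroup] additive_subgroup.a_closed[OF is_additive_subgroup]
      I_l_closed I_r_closed by auto
qed

abbreviation free_ideal :: "('l word \<Rightarrow>\<^sub>0 'k::field) set \<Rightarrow> ('l word \<Rightarrow>\<^sub>0 'k) set"
  where "free_ideal R \<equiv> Idl\<^bsub>free_alg\<^esub> R"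

lemma ideal_free_ideal: "ideal (free_ideal R) free_alg"
  using ring.genideal_ideal[OF ring_free_alg] by simp

lemma free_ideal_superset: "R \<subseteq> free_ideal R"
  using ring.genideal_self[OF ring_free_alg] by simp

lemma free_ideal_minimal: "ideal J free_alg \<Longrightarrow> R \<subseteq> J \<Longrightarrow> free_ideal R \<subseteq> J"
  using ring.genideal_minimal[OF ring_free_alg] by blast

lemma free_ideal_scale: "p \<in> free_ideal R \<Longrightarrow> c \<star> p \<in> free_ideal R"
  using ideal_free_algD(3)[OF ideal_free_ideal] by (simp add: scalar_mult_def)

lemma subspace_free_ideal: "fa.subspace (free_ideal R)"
  by (rule fa.subspaceI) (auto intro: ideal_free_algD[OF ideal_free_ideal] free_ideal_scale)

text \<open>
  The algebras in question are quotients of quotients.  A surjection from the free algebra, with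
  generators of its kernel, reduces statements about the cosets of cosets to statements about
  elements of the free algebra.
\<close>
locale presented_algebra =
  fixes A :: "('k::field, 'a) module" (structure)
    and \<pi> :: "('l word \<Rightarrow>\<^sub>0 'k) \<Rightarrow> 'a" and R :: "('l word \<Rightarrow>\<^sub>0 'k) set"
  assumes is_ring: "ring A" and alg_hom: "\<pi> \<in> alg_hom free_alg A" and surj: "range \<pi> = carrier A"
    and kernel: "\<pi> p = \<zero> \<longleftrightarrow> p \<in> free_ideal R"
begin

sublocale ring A by (rule is_ring)

lemma pi_closed [simp]: "\<pi> p \<in> carrier A"
  using surj by blast

lemma pi_add: "\<pi> (p + q) = \<pi> p \<oplus> \<pi> q" and pi_mult: "\<pi> (p * q) = \<pi> p \<otimes> \<pi> q"
  and pi_one: "\<pi> 1 = \<one>" and pi_scale: "\<pi> (c \<star> p) = c \<odot> \<pi> p"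
  using alg_hom by (auto simp: alg_hom_def ring_hom_def)

lemma pi_zero [simp]: "\<pi> 0 = \<zero>"
  using kernel ideal_free_algD(1)[OF ideal_free_ideal] by blast

lemma pi_uminus: "\<pi> (- p) = \<ominus> \<pi> p"
  using minus_equality[of "\<pi> (- p)" "\<pi> p"] by (simp flip: pi_add)

lemma pi_diff: "\<pi> (p - q) = \<pi> p \<ominus> \<pi> q"
  by (metis pi_add pi_uminus a_minus_def diff_conv_add_uminus)

lemma pi_eq_iff: "\<pi> p = \<pi> q \<longleftrightarrow> p - q \<in> free_ideal R"
proof
  assume "\<pi> p = \<pi> q"
  then have "\<pi> (p - q) = \<zero>" by (simp add: pi_diff a_minus_def r_neg)
  then show "p - q \<in> free_ideal R" by (simp add: kernel)
next
  assume "p - q \<in> free_ideal R"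
  then have "\<pi> (p - q) = \<zero>" by (simp add: kernel)
  moreover have "\<pi> p = \<pi> (p - q) \<oplus> \<pi> q" by (simp flip: pi_add)
  ultimately show "\<pi> p = \<pi> q" by simp
qed

lemma is_ring_hom: "ring_hom_ring free_alg A \<pi>"
  using alg_hom by (intro ring_hom_ringI2 ring_free_alg is_ring) (simp add: alg_hom_def)

lemma ideal_image:
  assumes "ideal J free_alg"
  shows "ideal (\<pi> ` J) A"
proof (rule idealI[OF is_ring])
  have "\<ominus> \<pi> p \<in> \<pi> ` J" if "p \<in> J" for p
    using ideal_free_algD(3)[OF assms that, of "-1"] by (auto simp flip: pi_uminus)
  then show "subgroup (\<pi> ` J) (add_monoid A)"
    using ideal_free_algD(1,2)[OF assms]
    by (intro subgroup.intro) (auto simp flip: pi_add a_inv_def simp: image_iff intro: pi_zero[symmetric])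
qed (use ideal_free_algD(3,4)[OF assms] in \<open>auto simp flip: pi_mult surj\<close>)

lemma image_ideal_iff: "\<pi> p \<in> Idl (\<pi> ` S) \<longleftrightarrow> p \<in> free_ideal (R \<union> S)"
proof
  have "ideal {p \<in> carrier free_alg. \<pi> p \<in> Idl (\<pi> ` S)} free_alg"
    by (rule ring_hom_ring.ideal_vimage[OF is_ring_hom], rule genideal_ideal) auto
  moreover have "R \<union> S \<subseteq> {p \<in> carrier free_alg. \<pi> p \<in> Idl (\<pi> ` S)}"
  proof -
    have "\<pi> p \<in> Idl (\<pi> ` S)" if "p \<in> R" for p
    proof -
      interpret I: ideal "Idl (\<pi> ` S)" A by (rule genideal_ideal) auto
      have "\<pi> p = \<zero>" using that free_ideal_superset kernel by blast
      then show ?thesis by simp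
    qed
    moreover have "\<pi> ` S \<subseteq> Idl (\<pi> ` S)" by (rule genideal_self) auto
    ultimately show ?thesis by auto
  qed
  ultimately have "free_ideal (R \<union> S) \<subseteq> {p \<in> carrier free_alg. \<pi> p \<in> Idl (\<pi> ` S)}"
    by (rule free_ideal_minimal)
  then show "p \<in> free_ideal (R \<union> S) \<Longrightarrow> \<pi> p \<in> Idl (\<pi> ` S)" by auto
next
  assume p: "\<pi> p \<in> Idl (\<pi> ` S)"
  have "Idl (\<pi> ` S) \<subseteq> \<pi> ` free_ideal (R \<union> S)"
    using free_ideal_superset[of "R \<union> S"]
    by (intro genideal_minimal ideal_image ideal_free_ideal) auto
  with p obtain q where q: "q \<in> free_ideal (R \<union> S)" "\<pi> p = \<pi> q" by blast
  have "free_ideal R \<subseteq> free_ideal (R \<union> S)"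
    using free_ideal_superset[of "R \<union> S"] by (intro free_ideal_minimal ideal_free_ideal) auto
  with q have "p - q \<in> free_ideal (R \<union> S)" by (auto simp: pi_eq_iff)
  from ideal_free_algD(2)[OF ideal_free_ideal this q(1)] show "p \<in> free_ideal (R \<union> S)" by simp
qed

text \<open>
  Dividing by further relations adds their lifts to the generators of the kernel.
\<close>
theorem presented_quotient:
  "presented_algebra (quot_alg A (\<pi> ` S)) (\<lambda>p. quot_proj A (\<pi> ` S) (\<pi> p)) (R \<union> S)"
proof -
  define I where "I = Idl (\<pi> ` S)"
  interpret I: ideal I A unfolding I_def by (rule genideal_ideal) auto
  have quot: "quot_alg A (\<pi> ` S) = \<lparr>carrier = carrier (A Quot I), mult = mult (A Quot I),
      one = one (A Quot I), zero = zero (A Quot I), add = add (A Quot I), smult = coset_smult A I\<rparr>"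
    by (simp add: quot_alg_def Let_def I_def)
  have proj: "quot_proj A (\<pi> ` S) = (+>) I"
    by (simp add: quot_proj_def I_def fun_eq_iff)
  have scale: "coset_smult A I c (I +> \<pi> p) = I +> (c \<odot> \<pi> p)" for c p
  proof -
    have "I +> (c \<odot> x) = I +> (c \<odot> \<pi> p)" if x: "x \<in> I +> \<pi> p" for x
    proof -
      obtain h where h: "h \<in> I" "x = h \<oplus> \<pi> p" using x by (auto simp: a_r_coset_def')
      then obtain q where q: "h = \<pi> q" using surj I.a_Hcarr by blast
      have "\<pi> (c \<star> q) \<in> I"
        using h q by (simp add: scalar_mult_def pi_mult I.I_l_closed)
      then have "\<pi> (c \<star> q) \<oplus> \<pi> (c \<star> p) \<in> I +> \<pi> (c \<star> p)"
        by (auto simp: a_r_coset_def')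
      then show ?thesis
        using a_repr_independence[of "\<pi> (c \<star> q) \<oplus> \<pi> (c \<star> p)" I "\<pi> (c \<star> p)"] I.a_subgroup unfolding h q
        by (simp add: pi_scale[symmetric] pi_add[symmetric] fa.scale_right_distrib)
    qed
    moreover have "\<pi> p \<in> I +> \<pi> p" by (rule I.a_rcos_self) simp
    ultimately show ?thesis unfolding coset_smult_def by blast
  qed
  show ?thesis
  proof (rule presented_algebra.intro)
    show "ring (quot_alg A (\<pi> ` S))"
      unfolding quot by (intro ring_same_operations I.quotient_is_ring)
    show "(\<lambda>p. quot_proj A (\<pi> ` S) (\<pi> p)) \<in> alg_hom free_alg (quot_alg A (\<pi> ` S))"
      using I.rcos_ring_hom unfolding quot proj
      by (auto simp: alg_hom_def ring_hom_def pi_add pi_mult pi_one pi_scale scale)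
    show "range (\<lambda>p. quot_proj A (\<pi> ` S) (\<pi> p)) = carrier (quot_alg A (\<pi> ` S))"
      unfolding quot proj by (auto simp: FactRing_def A_RCOSETS_def' a_r_coset_def' simp flip: surj)
    fix p
    have "I +> \<pi> p = I \<longleftrightarrow> \<pi> p \<in> I"
      using I.a_rcos_self[of "\<pi> p"] a_coset_join2[of "\<pi> p" I] I.a_subgroup by auto
    then show "quot_proj A (\<pi> ` S) (\<pi> p) = \<zero>\<^bsub>quot_alg A (\<pi> ` S)\<^esub> \<longleftrightarrow> p \<in> free_ideal (R \<union> S)"
      unfolding quot proj image_ideal_iff[symmetric] I_def[symmetric] by (simp add: FactRing_def)
  qed
qed

end

lemma presented_free_alg: "presented_algebra free_alg (\<lambda>p. p) {}"
proof (rule presented_algebra.intro)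
  have "ideal {0} (free_alg :: ('k::field, 'l word \<Rightarrow>\<^sub>0 'k) module)"
    by (rule ideal_free_algI) auto
  from free_ideal_minimal[OF this, of "{}"] ideal_free_algD(1)[OF ideal_free_ideal]
  show "p = \<zero>\<^bsub>free_alg\<^esub> \<longleftrightarrow> p \<in> free_ideal {}" for p :: "'l word \<Rightarrow>\<^sub>0 'k::field"
    by auto
qed (rule ring_free_alg, auto simp: alg_hom_def ring_hom_def)

section \<open>Maps determined by the generators\<close>

text \<open>
  This gives the uniqueness of the natural map; \<open>G\<close> is a bare record because the operations of
  \<open>gr_alg\<close> are only understood on symbols.
\<close>
lemma alg_hom_eq_on_words:
  assumes h: "h \<in> alg_hom free_alg G" and h': "h' \<in> alg_hom free_alg G"
    and gen: "\<And>x. h (word_mono [x]) = h' (word_mono [x])"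
  shows "h p = h' p"
proof -
  have hom: "f (p + q) = f p \<oplus>\<^bsub>G\<^esub> f q" "f (p * q) = f p \<otimes>\<^bsub>G\<^esub> f q" "f 1 = \<one>\<^bsub>G\<^esub>" "f (c \<star> p) = c \<odot>\<^bsub>G\<^esub> f p"
    if "f \<in> alg_hom free_alg G" for f and p q :: "'a word \<Rightarrow>\<^sub>0 'b" and c
    using that by (auto simp: alg_hom_def ring_hom_def)
  have word: "h (word_mono xs) = h' (word_mono xs)" for xs
  proof (induction xs)
    case (Cons x xs)
    then show ?case
      using word_mono_append[of "[x]" xs, where 'b='b, symmetric] gen by (simp add: hom h h')
  qed (simp add: word_mono_Nil hom h h')
  show ?thesis
  proof (induction p rule: poly_mapping_single_induct)
    case zero
    have "h (0 \<star> 1) = h' (0 \<star> 1)" by (simp only: hom[OF h] hom[OF h'])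
    then show ?case by simp
  qed (simp add: hom[OF h] hom[OF h'] single_eq_scale word)
qed

theorem (in presented_algebra) unique_induced_isomorphism:
  assumes \<Phi>: "\<Phi> \<in> alg_hom free_alg G" and range: "range \<Phi> = carrier G"
    and eq_iff: "\<And>p q. \<Phi> p = \<Phi> q \<longleftrightarrow> \<pi> p = \<pi> q"
  shows "\<exists>\<phi>. {h \<in> alg_hom A G \<inter> extensional (carrier A). \<forall>x. h (\<pi> (word_mono [x])) = \<Phi> (word_mono [x])} = {\<phi>}
    \<and> \<phi> \<in> alg_iso A G"
proof -
  define \<phi> where "\<phi> = restrict (\<lambda>a. \<Phi> (SOME p. \<pi> p = a)) (carrier A)"
  have \<phi>: "\<phi> (\<pi> p) = \<Phi> p" for p
    by (simp add: \<phi>_def eq_iff) (rule someI[of _ p], simp)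
  have mem: "a \<in> carrier A \<longleftrightarrow> (\<exists>p. a = \<pi> p)" for a using surj by blast
  have "\<Phi> p \<in> carrier G" for p using range by blast
  then have hom: "\<phi> \<in> alg_hom A G"
    using \<Phi> range by (auto simp: alg_hom_def ring_hom_def mem \<phi> pi_one[symmetric]
        simp flip: pi_add pi_mult pi_scale)
  have "bij_betw \<phi> (carrier A) (carrier G)"
    unfolding bij_betw_def inj_on_def
    by (auto simp: mem \<phi> eq_iff simp flip: range) (metis \<phi> image_eqI mem)
  with hom have iso: "\<phi> \<in> alg_iso A G" by (simp add: alg_iso_def)
  have ext: "\<phi> \<in> extensional (carrier A)" by (simp add: \<phi>_def)
  have unique: "h = \<phi>" if h: "h \<in> alg_hom A G" "h \<in> extensional (carrier A)"
    and gen: "\<forall>x. h (\<pi> (word_mono [x])) = \<Phi> (word_mono [x])" for h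
  proof (rule extensionalityI[OF h(2) ext])
    fix a assume "a \<in> carrier A"
    then obtain p where p: "a = \<pi> p" using mem by blast
    have "(\<lambda>p. h (\<pi> p)) \<in> alg_hom free_alg G"
      using h(1) by (auto simp: alg_hom_def ring_hom_def pi_add pi_mult pi_one pi_scale)
    from alg_hom_eq_on_words[OF this \<Phi> gen[rule_format]] show "h a = \<phi> a" by (simp add: p \<phi>)
  qed
  have gen: "\<forall>x. \<phi> (\<pi> (word_mono [x])) = \<Phi> (word_mono [x])" by (simp add: \<phi>)
  show ?thesis
    by (rule exI[of _ \<phi>]) (use unique iso hom ext gen in blast)
qed

section \<open>The associated graded algebra of a presented algebra\<close>

context presented_algebra
begin

definition filt :: "nat \<Rightarrow> 'a set"
  where "filt n = \<pi> ` words_less (Suc n)"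

lemma fil_pred_filt: "fil_pred A filt n = \<pi> ` words_less n"
proof (cases n)
  case 0
  have "words_less 0 = {0 :: 'l word \<Rightarrow>\<^sub>0 'k}" by (auto simp: words_less_def)
  with 0 show ?thesis by (simp add: fil_pred_def)
qed (simp add: fil_pred_def filt_def)

abbreviation coset :: "nat \<Rightarrow> ('l word \<Rightarrow>\<^sub>0 'k) \<Rightarrow> 'a set"
  where "coset n p \<equiv> fil_pred A filt n +> \<pi> p"

lemma coset_eq_image: "coset n p = (\<lambda>q. \<pi> (q + p)) ` words_less n"
  by (auto simp: fil_pred_filt a_r_coset_def' pi_add)

lemma words_less_closed:
  "p \<in> words_less n \<Longrightarrow> q \<in> words_less n \<Longrightarrow> p + q \<in> words_less n"
  "p \<in> words_less n \<Longrightarrow> q \<in> words_less n \<Longrightarrow> p - q \<in> words_less n"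
  "p \<in> words_less n \<Longrightarrow> c \<star> p \<in> words_less n" "0 \<in> words_less n"
  using subspace_words_less by (blast intro: fa.subspace_add fa.subspace_diff fa.subspace_scale fa.subspace_0)+

lemma coset_eq_iff: "coset n p = coset n q \<longleftrightarrow> \<pi> (p - q) \<in> \<pi> ` words_less n"
proof
  assume "coset n p = coset n q"
  moreover have "\<pi> (0 + p) \<in> coset n p" unfolding coset_eq_image using words_less_closed by blast
  ultimately obtain s where "s \<in> words_less n" "\<pi> p = \<pi> (s + q)" by (auto simp: coset_eq_image)
  then have "\<pi> (p - q) = \<pi> s" by (simp add: pi_eq_iff algebra_simps)
  with \<open>s \<in> words_less n\<close> show "\<pi> (p - q) \<in> \<pi> ` words_less n" by blast
next
  assume "\<pi> (p - q) \<in> \<pi> ` words_less n"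
  then obtain s where s: "s \<in> words_less n" "\<pi> (p - q) = \<pi> s" by blast
  have shift: "coset n p \<subseteq> coset n q" if "s \<in> words_less n" "\<pi> (p - q) = \<pi> s" for p q s
  proof -
    have "\<pi> (t + p) = \<pi> ((t + s) + q)" for t
      using that(2) by (simp add: pi_eq_iff algebra_simps)
    with that(1) show ?thesis unfolding coset_eq_image using words_less_closed(1) by blast
  qed
  have "\<pi> (q - p) = \<pi> (0 - s)" using s(2) ideal_free_algD(3)[OF ideal_free_ideal, of "p - q - s" R "-1"]
    by (simp add: pi_eq_iff algebra_simps)
  with shift[OF s] shift[of "0 - s" q p] s words_less_closed show "coset n p = coset n q" by blast
qed

lemma coset_eqI: "p - q \<in> words_less n \<Longrightarrow> coset n p = coset n q"
  by (simp add: coset_eq_iff)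

lemma coset_zero: "coset n 0 = fil_pred A filt n"
  unfolding coset_eq_image by (simp add: fil_pred_filt)

text \<open>
  The symbol collects the classes of all homogeneous components, not only of the top one.  Thus it is
  an algebra map from the whole free algebra.
\<close>
definition symbol :: "('l word \<Rightarrow>\<^sub>0 'k) \<Rightarrow> nat \<Rightarrow> 'a set"
  where "symbol p n = coset n (homcomp n p)"

lemma symbol_vanishes: "homcomp n p = 0 \<Longrightarrow> symbol p n = fil_pred A filt n"
  using coset_zero by (simp add: symbol_def)

lemma pi_sum: "finite I \<Longrightarrow> \<pi> (\<Sum>i\<in>I. f i) = (\<Oplus>i\<in>I. \<pi> (f i))"
  by (induction I rule: finite_induct) (auto simp: pi_add finsum_insert)

text \<open>
  All choices of representatives in \<open>gr_mult\<close> differ from the homogeneous components by terms of lower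
  degree, so the union there is a single coset.
\<close>
lemma symbol_mult: "gr_mult A filt (symbol p) (symbol q) = symbol (p * q)"
proof
  fix n
  have coset: "fil_pred A filt n +> (\<Oplus>i\<in>{..n}. a i \<otimes> b (n - i)) = symbol (p * q) n"
    if a: "\<forall>i\<le>n. a i \<in> symbol p i" and b: "\<forall>i\<le>n. b i \<in> symbol q i" for a b
  proof -
    have "\<forall>i\<in>{..n}. \<exists>s. s \<in> words_less i \<and> a i = \<pi> (s + homcomp i p)"
      using a by (auto simp: symbol_def coset_eq_image)
    then obtain s where s: "\<forall>i\<in>{..n}. s i \<in> words_less i \<and> a i = \<pi> (s i + homcomp i p)"
      by (rule bchoice[THEN exE])
    have "\<forall>i\<in>{..n}. \<exists>s. s \<in> words_less i \<and> b i = \<pi> (s + homcomp i q)"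
      using b by (auto simp: symbol_def coset_eq_image)
    then obtain t where t: "\<forall>i\<in>{..n}. t i \<in> words_less i \<and> b i = \<pi> (t i + homcomp i q)"
      by (rule bchoice[THEN exE])
    have "(\<Oplus>i\<in>{..n}. a i \<otimes> b (n - i)) =
        (\<Oplus>i\<in>{..n}. \<pi> ((s i + homcomp i p) * (t (n - i) + homcomp (n - i) q)))"
      using s t by (intro finsum_cong') (auto simp: pi_mult)
    also have "\<dots> = \<pi> (\<Sum>i\<le>n. (s i + homcomp i p) * (t (n - i) + homcomp (n - i) q))"
      by (simp add: pi_sum)
    finally have sum: "(\<Oplus>i\<in>{..n}. a i \<otimes> b (n - i)) =
        \<pi> (\<Sum>i\<le>n. (s i + homcomp i p) * (t (n - i) + homcomp (n - i) q))" .
    have "(\<Sum>i\<le>n. (s i + homcomp i p) * (t (n - i) + homcomp (n - i) q)) - homcomp n (p * q) =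
        (\<Sum>i\<le>n. s i * (t (n - i) + homcomp (n - i) q) + homcomp i p * t (n - i))"
      by (simp add: homcomp_mult distrib_left distrib_right sum.distrib algebra_simps)
    also have "\<dots> \<in> words_less n"
    proof (rule fa.subspace_sum[OF subspace_words_less])
      fix i assume i: "i \<in> {..n}"
      have "t (n - i) \<in> words_less (Suc (n - i))"
        using t words_less_mono[of "n - i" "Suc (n - i)"] by (auto simp: subset_iff)
      then have "s i * (t (n - i) + homcomp (n - i) q) \<in> words_less (i + (n - i))"
        using s i by (intro words_less_mult' words_less_closed homcomp_words_less) auto
      moreover have "homcomp i p * t (n - i) \<in> words_less (i + (n - i))"
        using t by (intro words_less_mult homcomp_words_less) auto
      ultimately show "s i * (t (n - i) + homcomp (n - i) q) + homcomp i p * t (n - i) \<in> words_less n"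
        using i words_less_closed by simp
    qed
    finally show ?thesis unfolding sum symbol_def by (rule coset_eqI)
  qed
  have "\<pi> (0 + homcomp i p) \<in> symbol p i" for i p
    unfolding symbol_def coset_eq_image using words_less_closed(4) by blast
  then have a: "\<forall>i\<le>n. \<pi> (0 + homcomp i p) \<in> symbol p i" and b: "\<forall>i\<le>n. \<pi> (0 + homcomp i q) \<in> symbol q i"
    by blast+
  show "gr_mult A filt (symbol p) (symbol q) n = symbol (p * q) n"
  proof (intro equalityI subsetI)
    fix x assume "x \<in> gr_mult A filt (symbol p) (symbol q) n"
    then show "x \<in> symbol (p * q) n" unfolding gr_mult_def using coset by blast
  next
    fix x assume "x \<in> symbol (p * q) n"
    then show "x \<in> gr_mult A filt (symbol p) (symbol q) n"
      unfolding gr_mult_def coset[OF a b, symmetric] using a b by (intro UN_I[OF CollectI] ) auto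
  qed
qed

lemma symbol_add: "set_add A (symbol p n) (symbol q n) = symbol (p + q) n"
proof -
  have sum: "\<pi> (s + homcomp n p) \<oplus> \<pi> (t + homcomp n q) = \<pi> ((s + t) + homcomp n (p + q))" for s t
    by (simp add: homcomp_add pi_add[symmetric] ac_simps)
  show ?thesis
  proof (intro equalityI subsetI)
    fix x assume "x \<in> set_add A (symbol p n) (symbol q n)"
    then show "x \<in> symbol (p + q) n"
      by (auto simp: symbol_def coset_eq_image set_add_def' sum intro: words_less_closed)
  next
    fix x assume "x \<in> symbol (p + q) n"
    then obtain s where s: "s \<in> words_less n" "x = \<pi> (s + homcomp n (p + q))"
      by (auto simp: symbol_def coset_eq_image)
    then have "x = \<pi> (s + homcomp n p) \<oplus> \<pi> (0 + homcomp n q)" by (simp only: sum add_0_right)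
    moreover have "\<pi> (s + homcomp n p) \<in> symbol p n" "\<pi> (0 + homcomp n q) \<in> symbol q n"
      unfolding symbol_def coset_eq_image using s(1) words_less_closed(4) by blast+
    ultimately show "x \<in> set_add A (symbol p n) (symbol q n)" unfolding set_add_def' by blast
  qed
qed

lemma symbol_scale: "coset_smult A (fil_pred A filt n) c (symbol p n) = symbol (c \<star> p) n"
proof -
  have "fil_pred A filt n +> (c \<odot> x) = symbol (c \<star> p) n" if x: "x \<in> symbol p n" for x
  proof -
    obtain s where s: "s \<in> words_less n" "x = \<pi> (s + homcomp n p)"
      using x by (auto simp: symbol_def coset_eq_image)
    show ?thesis unfolding s symbol_def pi_scale[symmetric]
      by (rule coset_eqI) (simp add: homcomp_scale fa.scale_right_distrib s words_less_closed)
  qed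
  moreover have "symbol p n \<noteq> {}"
    using words_less_closed(4) by (auto simp: symbol_def coset_eq_image)
  ultimately show ?thesis unfolding coset_smult_def by blast
qed

lemma symbol_homogeneous:
  assumes "homcomp n p = p"
  shows "gr_class A filt n (\<pi> p) = symbol p"
proof
  fix m
  show "gr_class A filt n (\<pi> p) m = symbol p m"
  proof (cases "m = n")
    case False
    with homcomp_homcomp[of m n p] have "homcomp m p = 0" by (simp add: assms)
    with False show ?thesis by (simp add: gr_class_def symbol_vanishes)
  qed (use assms in \<open>simp add: gr_class_def symbol_def\<close>)
qed

lemma symbol_in_carrier: "symbol p \<in> carrier (gr_alg A filt)"
proof -
  obtain N where N: "p \<in> words_less N" using ex_words_less by blast
  have "symbol p n = fil_pred A filt n" if "N \<le> n" for n
    using homcomp_of_words_less[of p n] words_less_mono[OF that] N by (intro symbol_vanishes) blast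
  then have "{n. symbol p n \<noteq> fil_pred A filt n} \<subseteq> {..<N}" by (auto simp: not_less[symmetric])
  then have "finite {n. symbol p n \<noteq> fil_pred A filt n}" by (rule finite_subset) simp
  moreover have "symbol p n \<in> (\<lambda>a. fil_pred A filt n +> a) ` filt n" for n
    unfolding symbol_def filt_def using homcomp_words_less by blast
  ultimately show ?thesis by (simp add: gr_alg_def)
qed

theorem symbol_hom: "symbol \<in> alg_hom free_alg (gr_alg A filt)"
proof -
  have "symbol 1 = gr_class A filt 0 \<one>"
    using symbol_homogeneous[of 0 1] homcomp_word_mono[of 0 "[] :: 'l list", where 'b='k]
    by (simp add: pi_one word_mono_Nil)
  then show ?thesis
    by (auto simp: alg_hom_def ring_hom_def symbol_in_carrier)
      (auto simp: gr_alg_def symbol_mult symbol_add symbol_scale)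
qed

theorem symbol_surj: "range symbol = carrier (gr_alg A filt)"
proof (intro equalityI subsetI)
  fix g assume g: "g \<in> carrier (gr_alg A filt)"
  then have "\<forall>n. \<exists>p. p \<in> words_less (Suc n) \<and> g n = coset n p"
    by (auto simp: gr_alg_def filt_def)
  then obtain p where p: "p n \<in> words_less (Suc n)" "g n = coset n (p n)" for n by metis
  define N where "N = {n. g n \<noteq> fil_pred A filt n}"
  have fin: "finite N" using g by (simp add: gr_alg_def N_def)
  have top: "p n - homcomp n (p n) \<in> words_less n" for n
    using p(1)[of n] by (auto simp: words_less_def in_keys_iff lookup_minus lookup_homcomp less_Suc_eq split: if_splits)
  have comp: "homcomp n (\<Sum>m\<in>N. homcomp m (p m)) = (if n \<in> N then homcomp n (p n) else 0)" for n
  proof -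
    have "homcomp n (\<Sum>m\<in>N. homcomp m (p m)) = (\<Sum>m\<in>N. homcomp n (homcomp m (p m)))"
      using fin by (induction N rule: finite_induct) (auto simp: homcomp_add)
    also have "\<dots> = (\<Sum>m\<in>N. if n = m then homcomp n (p n) else 0)"
      by (intro sum.cong) (auto simp: homcomp_homcomp)
    finally show ?thesis using fin by simp
  qed
  have "symbol (\<Sum>m\<in>N. homcomp m (p m)) n = g n" for n
  proof (cases "n \<in> N")
    case True
    then show ?thesis using coset_eqI[OF top[of n]] by (simp add: symbol_def comp p(2))
  next
    case False
    then have "homcomp n (\<Sum>m\<in>N. homcomp m (p m)) = 0" by (simp add: comp)
    with False show ?thesis by (simp add: symbol_vanishes N_def)
  qed
  then show "g \<in> range symbol" by (metis ext rangeI)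
qed (use symbol_in_carrier in auto)

lemma symbol_eq_iff: "symbol p = symbol q \<longleftrightarrow> (\<forall>n. \<pi> (homcomp n (p - q)) \<in> \<pi> ` words_less n)"
  by (simp add: fun_eq_iff symbol_def coset_eq_iff homcomp_diff)

lemma ideal_symbol_kernel: "ideal {p. \<forall>n. \<pi> (homcomp n p) \<in> \<pi> ` words_less n} free_alg"
proof -
  have "{p. \<forall>n. \<pi> (homcomp n p) \<in> \<pi> ` words_less n} = {p. symbol p = symbol 0}"
    by (simp add: symbol_eq_iff)
  moreover have "ideal {p. symbol p = symbol 0} free_alg"
  proof (rule ideal_free_algI)
    fix p q assume p: "p \<in> {p. symbol p = symbol 0}"
    show "q * p \<in> {p. symbol p = symbol 0}" "p * q \<in> {p. symbol p = symbol 0}"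
      using p symbol_mult[of q p] symbol_mult[of q 0] symbol_mult[of p q] symbol_mult[of 0 q] by simp_all
    assume "q \<in> {p. symbol p = symbol 0}"
    then show "p + q \<in> {p. symbol p = symbol 0}"
      using p symbol_add[of p _ q, symmetric] symbol_add[of 0 _ 0] by (auto simp: fun_eq_iff)
  qed simp
  ultimately show ?thesis by simp
qed

end

section \<open>The algebras of the theorem as presented algebras\<close>

definition env_word_rels :: "('l \<Rightarrow> 'l) \<Rightarrow> ('l \<Rightarrow> 'l \<Rightarrow> 'l) \<Rightarrow> ('l word \<Rightarrow>\<^sub>0 'k::field) set"
  where "env_word_rels D br =
    {word_mono [x] * word_mono [y] - word_mono [y] * word_mono [x]
      - word_mono [D y] * word_mono [D x] - word_mono [br x y] |x y. True}"

definition super_word_rels :: "'l set \<Rightarrow> ('l \<Rightarrow> 'l) \<Rightarrow> ('l word \<Rightarrow>\<^sub>0 'k::field) set"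
  where "super_word_rels L1 Q = {word_mono [y] * word_mono [y] - word_mono [Q y] |y. y \<in> L1}"

definition sym_word_rels :: "('l \<Rightarrow> 'l) \<Rightarrow> ('l word \<Rightarrow>\<^sub>0 'k::field) set"
  where "sym_word_rels D =
    {word_mono [x] * word_mono [y] - word_mono [y] * word_mono [x]
      - word_mono [D y] * word_mono [D x] |x y. True}"

definition square_word_rels :: "'l set \<Rightarrow> ('l word \<Rightarrow>\<^sub>0 'k::field) set"
  where "square_word_rels L1 = {word_mono [y] * word_mono [y] |y. y \<in> L1}"

context
  fixes scale :: "'k::field \<Rightarrow> 'l::ab_group_add \<Rightarrow> 'l"
begin

definition tensor_proj :: "('l word \<Rightarrow>\<^sub>0 'k) \<Rightarrow> ('l word \<Rightarrow>\<^sub>0 'k) set"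
  where "tensor_proj = quot_proj free_alg (multilinear_rels scale)"

lemma presented_tensor_alg: "presented_algebra (tensor_alg scale) tensor_proj (multilinear_rels scale)"
  using presented_algebra.presented_quotient[OF presented_free_alg, of "multilinear_rels scale"]
  by (simp add: tensor_alg_def tensor_proj_def)

lemma tensor_gen_eq: "tensor_gen scale x = tensor_proj (word_mono [x])"
  by (simp add: tensor_gen_def tensor_proj_def)

lemma presented_sym_super_alg:
  "presented_algebra (sym_super_alg scale D L1)
    (\<lambda>p. quot_proj (sym_alg scale D) (square_rels scale D L1)
      (quot_proj (tensor_alg scale) (sym_rels scale D) (tensor_proj p)))
    (multilinear_rels scale \<union> sym_word_rels D \<union> square_word_rels L1)"
proof -
  interpret T: presented_algebra "tensor_alg scale" tensor_proj "multilinear_rels scale"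
    by (rule presented_tensor_alg)
  have sym: "sym_rels scale D = tensor_proj ` sym_word_rels D"
    unfolding sym_rels_def sym_word_rels_def Let_def tensor_gen_eq T.pi_diff[symmetric] T.pi_mult[symmetric]
    by blast
  interpret S: presented_algebra "sym_alg scale D"
    "\<lambda>p. quot_proj (tensor_alg scale) (sym_rels scale D) (tensor_proj p)"
    "multilinear_rels scale \<union> sym_word_rels D"
    using T.presented_quotient[of "sym_word_rels D"] by (simp add: sym_alg_def sym)
  have sq: "square_rels scale D L1 =
      (\<lambda>p. quot_proj (tensor_alg scale) (sym_rels scale D) (tensor_proj p)) ` square_word_rels L1"
    unfolding square_rels_def square_word_rels_def sym_gen_def tensor_gen_eq S.pi_mult[symmetric] by blast
  show ?thesis
    using S.presented_quotient[of "square_word_rels L1"] by (simp add: sym_super_alg_def sq)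
qed

lemma presented_super_env_alg:
  "presented_algebra (super_env_alg scale D br L1 Q)
    (\<lambda>p. quot_proj (env_alg scale D br) (super_rels scale D br L1 Q)
      (quot_proj (tensor_alg scale) (env_rels scale D br) (tensor_proj p)))
    (multilinear_rels scale \<union> env_word_rels D br \<union> super_word_rels L1 Q)"
proof -
  interpret T: presented_algebra "tensor_alg scale" tensor_proj "multilinear_rels scale"
    by (rule presented_tensor_alg)
  have env: "env_rels scale D br = tensor_proj ` env_word_rels D br"
    unfolding env_rels_def env_word_rels_def Let_def tensor_gen_eq T.pi_diff[symmetric] T.pi_mult[symmetric]
    by blast
  interpret E: presented_algebra "env_alg scale D br"
    "\<lambda>p. quot_proj (tensor_alg scale) (env_rels scale D br) (tensor_proj p)"
    "multilinear_rels scale \<union> env_word_rels D br"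
    using T.presented_quotient[of "env_word_rels D br"] by (simp add: env_alg_def env)
  have sq: "super_rels scale D br L1 Q =
      (\<lambda>p. quot_proj (tensor_alg scale) (env_rels scale D br) (tensor_proj p)) ` super_word_rels L1 Q"
    unfolding super_rels_def super_word_rels_def env_gen_def tensor_gen_eq E.pi_mult[symmetric] E.pi_diff[symmetric]
    by blast
  show ?thesis
    using E.presented_quotient[of "super_word_rels L1 Q"] by (simp add: super_env_alg_def sq)
qed

end

section \<open>Comparison of the relations\<close>

lemma homcomp_homogeneous:
  assumes "keys p \<subseteq> {w. length (letters w) = n}"
  shows "homcomp m p = (if m = n then p else 0)"
  using assms by (intro poly_mapping_eqI) (auto simp: lookup_homcomp in_keys_iff subset_iff)

lemma multilinear_rels_homogeneous:
  assumes "q \<in> multilinear_rels scale"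
  shows "\<exists>m. \<forall>n. homcomp n q = (if n = m then q else 0)"
proof -
  consider us vs x y where "q = word_mono (us @ [x + y] @ vs) - word_mono (us @ [x] @ vs) - word_mono (us @ [y] @ vs)"
    | us vs c x where "q = word_mono (us @ [scale c x] @ vs) - c \<star> word_mono (us @ [x] @ vs)"
    using assms by (auto simp: multilinear_rels_def scalar_mult_def)
  then show ?thesis
  proof cases
    case (1 us vs x y)
    then show ?thesis
      by (auto simp: homcomp_diff homcomp_word_mono intro!: exI[of _ "length us + 1 + length vs"])
  next
    case (2 us vs c x)
    then show ?thesis
      by (auto simp: homcomp_diff homcomp_scale homcomp_word_mono
          intro!: exI[of _ "length us + 1 + length vs"])
  qed
qed

context adapted_basis
begin

abbreviation "sym_super_relations \<equiv> multilinear_rels scale \<union> sym_word_rels D \<union> square_word_rels L1"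
abbreviation "super_env_relations \<equiv> multilinear_rels scale \<union> env_word_rels D br \<union> super_word_rels L1 Q"

text \<open>
  The projection of the free algebra on all vectors of \<open>L\<close> onto the free algebra on the letters of
  \<open>B\<close>.  Its kernel is the ideal of the multilinear relations, so it identifies the tensor algebra
  with its image.
\<close>
definition expand :: "('l word \<Rightarrow>\<^sub>0 'k) \<Rightarrow> ('l word \<Rightarrow>\<^sub>0 'k)"
  where "expand = lin_ext (\<lambda>w. prod_list (map \<beta> (letters w)))"

lemma expand_zero [simp]: "expand 0 = 0"
  and expand_add: "expand (p + q) = expand p + expand q"
  and expand_diff: "expand (p - q) = expand p - expand q"
  and expand_scale: "expand (c \<star> p) = c \<star> expand p"
  and expand_mult: "expand (p * q) = expand p * expand q"
  and expand_word: "expand (word_mono xs) = prod_list (map \<beta> xs)"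
  by (simp_all add: expand_def lin_ext_add lin_ext_diff lin_ext_scale lin_ext_mult plus_word_def)

lemma keys_prod_beta: "keys (prod_list (map \<beta> xs)) \<subseteq> {w. length (letters w) = length xs}"
proof (induction xs)
  case Nil
  show ?case by (simp add: zero_word_def)
next
  case (Cons x xs)
  have "keys (\<beta> x) \<subseteq> {w. length (letters w) = 1}"
    using keys_beta[of B x] span_B by auto
  with Cons keys_mult[of "\<beta> x" "prod_list (map \<beta> xs)"] show ?case
    by (fastforce simp: plus_word_def)
qed

lemma homcomp_expand: "homcomp n (expand p) = expand (homcomp n p)"
proof (induction p rule: poly_mapping_single_induct)
  case (add w c p)
  then show ?case
    by (simp add: homcomp_add expand_add single_eq_scale homcomp_scale expand_scale homcomp_word_mono
        expand_word homcomp_homogeneous[OF keys_prod_beta])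
qed simp

lemma expand_words_less: "p \<in> words_less n \<Longrightarrow> expand p \<in> words_less n"
proof -
  assume p: "p \<in> words_less n"
  have "homcomp m (expand p) = 0" if "n \<le> m" for m
    using homcomp_of_words_less[of p m] words_less_mono[OF that] p by (auto simp: homcomp_expand)
  then have "lookup (expand p) w = 0" if "n \<le> length (letters w)" for w
    using lookup_homcomp[of "length (letters w)" "expand p" w] that by simp
  then show ?thesis by (auto simp: words_less_def in_keys_iff not_le[symmetric])
qed

lemma beta_congruent: "word_mono [x] - \<beta> x \<in> free_ideal (multilinear_rels scale)"
proof -
  let ?M = "free_ideal (multilinear_rels scale)"
  have rel: "word_mono [x + y] - word_mono [x] - word_mono [y] \<in> ?M" "word_mono [scale c x] - c \<star> word_mono [x] \<in> ?M" for x y c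
    using free_ideal_superset[of "multilinear_rels scale"]
    unfolding multilinear_rels_def scalar_mult_def
    by (force intro: exI[of _ "[]"])+
  have "x \<in> span B" by (simp add: span_B)
  then show ?thesis
  proof (induction rule: span_induct_alt)
    case base
    show ?case using rel(2)[of 0 0] by simp
  next
    case (step c b x)
    have "(word_mono [scale c b + x] - word_mono [scale c b] - word_mono [x])
        + (word_mono [scale c b] - c \<star> word_mono [b]) + (word_mono [x] - \<beta> x) \<in> ?M"
      using rel step subspace_free_ideal by (intro fa.subspace_add) auto
    with step show ?case by (simp add: beta_add beta_scale beta_basis algebra_simps)
  qed
qed

lemma expand_congruent: "p - expand p \<in> free_ideal (multilinear_rels scale)"
proof (induction p rule: poly_mapping_single_induct)
  case zero
  show ?case by (simp add: ideal_free_algD(1)[OF ideal_free_ideal])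
next
  case (add w c p)
  let ?M = "free_ideal (multilinear_rels scale)"
  have word: "word_mono xs - prod_list (map \<beta> xs) \<in> ?M" for xs
  proof (induction xs)
    case Nil
    show ?case by (simp add: word_mono_Nil ideal_free_algD(1)[OF ideal_free_ideal])
  next
    case (Cons x xs)
    have "(word_mono [x] - \<beta> x) * word_mono xs + \<beta> x * (word_mono xs - prod_list (map \<beta> xs)) \<in> ?M"
      using Cons beta_congruent by (intro ideal_free_algD(2-4)[OF ideal_free_ideal])
    then show ?case
      using word_mono_append[of "[x]" xs, where 'b='k] by (simp add: algebra_simps)
  qed
  have "c \<star> (word_mono (letters w) - prod_list (map \<beta> (letters w))) + (p - expand p) \<in> ?M"
    using word add subspace_free_ideal by (intro fa.subspace_add fa.subspace_scale) auto
  then show ?case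
    by (simp add: expand_add single_eq_scale[of w c] expand_scale expand_word fa.scale_right_diff_distrib algebra_simps)
qed

text \<open>
  Bounds on leading words are forgotten in order to transfer the criteria above to the span of all
  relations.
\<close>
lemma below_subset_span: "rw.below w \<subseteq> fa.span (rewriting_rel ` rewritings)"
  unfolding rw.below_def by (rule fa.span_mono) blast

lemma ideal_span_rewriting: "ideal (fa.span (rewriting_rel ` rewritings)) free_alg"
proof -
  let ?J = "fa.span (rewriting_rel ` rewritings)"
  have word: "word_mono u * p * word_mono v \<in> ?J" if "p \<in> ?J" for u v p
    using that
  proof (rule span_mult_closed)
    fix s assume "s \<in> rewriting_rel ` rewritings"
    then obtain u' a b v' where s: "s = rewriting_rel (u', a, b, v')" "(a, b) \<in> leading_pairs"
      by (auto simp: rewritings_def)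
    then have "word_mono u * s * word_mono v = rewriting_rel (u @ u', a, b, v' @ v)"
      "(u @ u', a, b, v' @ v) \<in> rewritings"
      by (simp_all add: word_mono_append[symmetric] mult.assoc rewritings_def)
    then show "word_mono u * s * word_mono v \<in> ?J" by (simp only: fa.span_base imageI)
  qed
  have "q * p \<in> ?J \<and> p * q \<in> ?J" if "p \<in> ?J" for p q
  proof (induction q rule: poly_mapping_single_induct)
    case (add w c q)
    with word[OF that, of "letters w" "[]"] word[OF that, of "[]" "letters w"] show ?case
      by (simp add: distrib_left distrib_right single_eq_scale[of w c] scale_mult word_mono_Nil
          fa.span_add fa.span_scale)
  qed (simp add: fa.span_zero)
  then show ?thesis
    by (intro ideal_free_algI) (auto intro: fa.span_zero fa.span_add)
qed

text \<open>
  Every word of length three bounds all words of a relation.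
\<close>
lemma comm_rel_in_span: "comm_rel x y \<in> fa.span (rewriting_rel ` rewritings)"
  using comm_rel_below_short[of "[0, 0, 0]"] below_subset_span by auto

lemma square_rel_in_span: "y \<in> L1 \<Longrightarrow> square_rel y \<in> fa.span (rewriting_rel ` rewritings)"
  using square_rel_below[of y "[]" "[]" "Word [0, 0, 0]"] below_subset_span
  by (auto simp: word_mono_Nil lenlex_conv)

lemma expand_super_env_relations:
  assumes "p \<in> free_ideal super_env_relations"
  shows "expand p \<in> fa.span (rewriting_rel ` rewritings)"
proof -
  let ?J = "fa.span (rewriting_rel ` rewritings)"
  have "ideal {p. expand p \<in> ?J} free_alg"
    using ideal_free_algD[OF ideal_span_rewriting]
    by (intro ideal_free_algI) (auto simp: expand_add expand_mult)
  moreover have "super_env_relations \<subseteq> {p. expand p \<in> ?J}"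
  proof -
    have "expand q = 0" if "q \<in> multilinear_rels scale" for q
      using that by (auto simp: multilinear_rels_def expand_diff expand_word beta_add beta_scale
          expand_scale distrib_left distrib_right scale_mult simp flip: scalar_mult_def)
    moreover have "expand q \<in> ?J" if q: "q \<in> env_word_rels D br" for q
    proof -
      obtain x y where "q = word_mono [x] * word_mono [y] - word_mono [y] * word_mono [x]
          - word_mono [D y] * word_mono [D x] - word_mono [br x y]"
        using q by (auto simp: env_word_rels_def)
      then have "expand q = comm_rel x y"
        by (simp add: expand_add expand_mult expand_word comm_rel_def fa_diff)
      then show ?thesis by (simp add: comm_rel_in_span)
    qed
    moreover have "expand q \<in> ?J" if q: "q \<in> super_word_rels L1 Q" for q
    proof -
      obtain y where y: "y \<in> L1" "q = word_mono [y] * word_mono [y] - word_mono [Q y]"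
        using q by (auto simp: super_word_rels_def)
      then have "expand q = square_rel y"
        by (simp add: expand_add expand_mult expand_word square_rel_def fa_diff)
      with y(1) show ?thesis by (simp add: square_rel_in_span)
    qed
    ultimately show ?thesis by (auto simp: fa.span_zero)
  qed
  ultimately show ?thesis using assms free_ideal_minimal by blast
qed

lemma free_ideal_mono: "R \<subseteq> R' \<Longrightarrow> free_ideal R \<subseteq> free_ideal R'"
  using free_ideal_superset[of R'] by (intro free_ideal_minimal ideal_free_ideal) auto

text \<open>
  The part of degree two of a rule of \<open>U\<close> is a relation of \<open>SL/(L1\<^sup>2)\<close>.
\<close>
lemma rule_rel_top:
  assumes "(a, b) \<in> leading_pairs"
  obtains t s where "rule_rel a b = t + s" "t \<in> free_ideal sym_super_relations"
    "keys t \<subseteq> {w. length (letters w) = 2}" "s \<in> words_less 2"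
proof -
  let ?I = "free_ideal sym_super_relations"
  have M: "expand p - p \<in> ?I" for p
  proof -
    have "p - expand p \<in> ?I"
      using expand_congruent[of p] free_ideal_mono[of "multilinear_rels scale" sym_super_relations] by blast
    then show ?thesis by (simp add: fa_diff add.commute)
  qed
  have expand_mem: "expand p \<in> ?I" if "p \<in> sym_word_rels D \<union> square_word_rels L1" for p
  proof -
    have "p \<in> ?I" using that free_ideal_superset[of sym_super_relations] by blast
    with M[of p] have "(expand p - p) + p \<in> ?I" by (intro ideal_free_algD(2)[OF ideal_free_ideal])
    then show ?thesis by simp
  qed
  have linear: "\<beta> x \<in> words_less 2" for x
    using keys_prod_beta[of "[x]"] by (force simp: words_less_def)
  have quad: "keys (\<beta> x * \<beta> y) \<subseteq> {w. length (letters w) = 2}" for x y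
    using keys_prod_beta[of "[x, y]"] by (simp add: numeral_2_eq_2)
  show ?thesis
  proof (cases "a = b")
    case True
    then have "a \<in> L1" using assms r_irrefl span_B1 span_base by (auto simp: leading_pairs_def)
    then have "\<beta> a * \<beta> a \<in> ?I"
      using expand_mem[of "word_mono [a] * word_mono [a]"]
      by (auto simp: square_word_rels_def expand_mult expand_word)
    with True quad linear that[of "\<beta> a * \<beta> a" "\<beta> (Q a)"] show ?thesis
      by (simp add: rule_rel_def square_rel_def)
  next
    case False
    let ?t = "\<beta> a * \<beta> b + \<beta> b * \<beta> a + \<beta> (D b) * \<beta> (D a)"
    have "expand (word_mono [a] * word_mono [b] - word_mono [b] * word_mono [a]
        - word_mono [D b] * word_mono [D a]) \<in> ?I"
      by (rule expand_mem) (auto simp: sym_word_rels_def)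
    then have "?t \<in> ?I"
      unfolding fa_diff by (simp add: expand_mult expand_word expand_add)
    moreover have "keys ?t \<subseteq> {w. length (letters w) = 2}"
      using quad keys_add by (meson Un_least order_trans)
    ultimately show ?thesis
      using False linear that[of ?t "\<beta> (br a b)"] by (simp add: rule_rel_def comm_rel_def)
  qed
qed

lemma words_less_context:
  assumes "s \<in> words_less m"
  shows "word_mono u * s * word_mono v \<in> words_less (length u + m + length v)"
  using keys_mult_mono[of u s v] assms by (fastforce simp: words_less_def)

lemma homcomp_rewriting:
  assumes "i \<in> rewritings" "length (letters (lead_word i)) \<le> n"
  shows "homcomp n (rewriting_rel i) \<in> free_ideal sym_super_relations"
proof -
  obtain u a b v where i: "i = (u, a, b, v)" and ab: "(a, b) \<in> leading_pairs"
    using assms(1) by (auto simp: rewritings_def)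
  obtain t s where ts: "rule_rel a b = t + s" "t \<in> free_ideal sym_super_relations"
    "keys t \<subseteq> {w. length (letters w) = 2}" "s \<in> words_less 2"
    using rule_rel_top[OF ab] .
  have len: "length u + 2 + length v \<le> n" using assms(2) by (simp add: i)
  have "word_mono u * s * word_mono v \<in> words_less n"
    using words_less_context[OF ts(4), of u v] words_less_mono[OF len] by blast
  then have "homcomp n (rewriting_rel i) = homcomp n (word_mono u * t * word_mono v)"
    by (simp add: i ts(1) distrib_left distrib_right homcomp_add homcomp_of_words_less)
  moreover have "keys (word_mono u * t * word_mono v) \<subseteq> {w. length (letters w) = length u + 2 + length v}"
    using keys_mult_mono[of u t v] ts(3) by fastforce
  moreover have "word_mono u * t * word_mono v \<in> free_ideal sym_super_relations"
    using ts(2) by (intro ideal_free_algD(3,4)[OF ideal_free_ideal])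
  ultimately show ?thesis
    by (simp add: homcomp_homogeneous ideal_free_algD(1)[OF ideal_free_ideal])
qed

text \<open>
  The expansion of \<open>q - t\<close> has no words longer than \<open>n\<close>, so by confluence it is a combination of
  multiples of rules that are no longer than \<open>n\<close>.  In degree \<open>n\<close> these multiples contribute relations
  of \<open>SL/(L1\<^sup>2)\<close>, while \<open>q - t\<close> contributes \<open>q\<close>.
\<close>
theorem symbol_of_relation:
  assumes "q - t \<in> free_ideal super_env_relations" "homcomp n q = q" "t \<in> words_less n"
  shows "q \<in> free_ideal sym_super_relations"
proof -
  let ?I = "free_ideal sym_super_relations" and ?p = "expand (q - t)"
  have "q \<in> words_less (Suc n)" using homcomp_words_less[of n q] assms(2) by simp
  moreover have "t \<in> words_less (Suc n)" using assms(3) words_less_mono[of n "Suc n"] by auto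
  ultimately have "q - t \<in> words_less (Suc n)"
    using subspace_words_less by (rule fa.subspace_diff[rotated 1])
  then have "?p \<in> words_less (Suc n)" by (rule expand_words_less)
  then have keys: "length (letters w) \<le> n" if "w \<in> keys ?p" for w
    using that by (auto simp: words_less_def)
  have "?p \<in> fa.span {rewriting_rel i |i. i \<in> rewritings \<and> (\<exists>v\<in>keys ?p. (lead_word i, v) \<in> word_order\<^sup>=)}"
    by (intro rw.reduction_controlled_by_keys confluent expand_super_env_relations assms(1))
  then have "homcomp n ?p \<in> ?I"
  proof (induction rule: fa.span_induct_alt)
    case base
    show ?case by (simp add: ideal_free_algD(1)[OF ideal_free_ideal])
  next
    case (step c x y)
    then obtain i v where i: "x = rewriting_rel i" "i \<in> rewritings" "v \<in> keys ?p" "(lead_word i, v) \<in> word_order\<^sup>="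
      by blast
    then have "length (letters (lead_word i)) \<le> length (letters v)"
      by (auto simp: word_order_def dest: lenlex_length)
    with keys[OF i(3)] i have "homcomp n x \<in> ?I" by (auto intro!: homcomp_rewriting simp del: rewriting_rel.simps)
    then show ?case
      unfolding homcomp_add homcomp_scale
      by (intro fa.subspace_add[OF subspace_free_ideal] fa.subspace_scale[OF subspace_free_ideal] step.IH)
  qed
  also have "homcomp n ?p = expand q"
    using assms(2) homcomp_of_words_less[OF assms(3)] by (simp add: homcomp_expand homcomp_diff)
  finally have "expand q \<in> ?I" .
  moreover have "q - expand q \<in> ?I"
    using expand_congruent free_ideal_mono[of "multilinear_rels scale" sym_super_relations] by blast
  ultimately have "(q - expand q) + expand q \<in> ?I" by (intro ideal_free_algD(2)[OF ideal_free_ideal])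
  then show ?thesis by simp
qed

end

section \<open>Existence of adapted bases\<close>

text \<open>
  The bases are obtained by extension along \<open>L1 \<subseteq> Ker D \<subseteq> L\<close>.
\<close>
lemma adapted_basis_exists:
  fixes scale :: "'k::field \<Rightarrow> 'l::ab_group_add \<Rightarrow> 'l"
  assumes "lie_superalgebra scale D br L0 L1 Q"
  shows "\<exists>B K B1 r \<beta>. adapted_basis scale D br L0 L1 Q B K B1 r \<beta>"
proof -
  interpret lie_superalgebra scale D br L0 L1 Q by fact
  have D: "D (x + y) = D x + D y" "D (scale c x) = scale c (D x)" for x y c
    using linear_D by (auto simp: Vector_Spaces.linear_iff)
  have ker: "subspace {x. D x = 0}"
    using D(2)[of 0 0] by (intro subspaceI) (auto simp: D)
  obtain B1 where B1: "B1 \<subseteq> L1" "independent B1" "L1 \<subseteq> span B1"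
    by (rule maximal_independent_subset)
  obtain K where K: "B1 \<subseteq> K" "K \<subseteq> {x. D x = 0}" "independent K" "{x. D x = 0} \<subseteq> span K"
    by (rule maximal_independent_subset_extend[OF order_trans[OF B1(1) L1_kernel] B1(2)])
  obtain B where B: "K \<subseteq> B" "independent B" "UNIV \<subseteq> span B"
    by (rule maximal_independent_subset_extend[OF subset_UNIV K(3)])
  interpret pair: vector_space_pair scale "scalar_mult :: 'k \<Rightarrow> ('l word \<Rightarrow>\<^sub>0 'k) \<Rightarrow> _"
    by unfold_locales
  obtain \<beta> :: "'l \<Rightarrow> ('l word \<Rightarrow>\<^sub>0 'k)"
    where \<beta>: "Vector_Spaces.linear scale scalar_mult \<beta>" "\<forall>b\<in>B. \<beta> b = word_mono [b]"
    using pair.linear_independent_extend[OF B(2), of "\<lambda>b. word_mono [b]"] by blast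
  obtain wo :: "('l \<times> 'l) set" where wo: "well_order_on UNIV wo"
    using well_order_on by blast
  \<comment> \<open>All vectors of \<open>Ker D\<close> precede the others; within the two classes any well-order serves.\<close>
  define key where "key x = (if D x = 0 then 0 else 1 :: nat, x)" for x
  define r where "r = inv_image (less_than <*lex*> (wo - Id)) key"
  have strict: "wf (wo - Id)" "trans (wo - Id)" "total (wo - Id)"
    using wo strict_linear_order_on_diff_Id[of UNIV wo]
    by (auto simp: well_order_on_def strict_linear_order_on_def)
  have "wf r" "trans r"
    unfolding r_def using strict by (auto intro: trans_inv_image)
  moreover have "total r"
    using strict(3) by (auto simp: total_on_def r_def key_def)
  moreover have "(x, y) \<in> r" if "D x = 0" "D y \<noteq> 0" for x y
    using that by (simp add: r_def key_def)
  moreover have "span B1 = L1" using B1 span_subspace[OF _ _ subspace_L1] by blast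
  moreover have "span K = {x. D x = 0}" using K span_subspace[OF _ _ ker] by blast
  moreover have "span B = UNIV" using B(3) by blast
  ultimately have "adapted_basis_axioms scale D L1 B K B1 r \<beta>"
    using B(1) K(1) \<beta> by (intro adapted_basis_axioms.intro) blast+
  then have "adapted_basis scale D br L0 L1 Q B K B1 r \<beta>"
    by (rule adapted_basis.intro[OF assms])
  then show ?thesis by blast
qed

theorem theorem3p25:
  fixes scale :: "'k::field \<Rightarrow> 'l::ab_group_add \<Rightarrow> 'l"
    and D :: "'l \<Rightarrow> 'l" and br :: "'l \<Rightarrow> 'l \<Rightarrow> 'l"
    and L0 L1 :: "'l set" and Q :: "'l \<Rightarrow> 'l"
  assumes "CHAR('k) = 2"
    and "lie_superalgebra scale D br L0 L1 Q"
  shows "\<exists>\<phi>. natural_maps scale D br L1 Q = {\<phi>} \<and>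
    \<phi> \<in> alg_iso (sym_super_alg scale D L1) (gr_super_env_alg scale D br L1 Q)"
proof -
  interpret lie_superalgebra scale D br L0 L1 Q by fact
  obtain B K B1 r \<beta> where "adapted_basis scale D br L0 L1 Q B K B1 r \<beta>"
    using adapted_basis_exists[OF assms(2)] by blast
  then interpret adapted_basis scale D br L0 L1 Q B K B1 r \<beta> .
  define \<sigma> where "\<sigma> p = quot_proj (sym_alg scale D) (square_rels scale D L1)
      (quot_proj (tensor_alg scale) (sym_rels scale D) (tensor_proj scale p))" for p
  define \<upsilon> where "\<upsilon> p = quot_proj (env_alg scale D br) (super_rels scale D br L1 Q)
      (quot_proj (tensor_alg scale) (env_rels scale D br) (tensor_proj scale p))" for p
  interpret S: presented_algebra "sym_super_alg scale D L1" \<sigma> sym_super_relations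
    using presented_sym_super_alg[of scale D L1] by (simp add: \<sigma>_def[abs_def])
  interpret U: presented_algebra "super_env_alg scale D br L1 Q" \<upsilon> super_env_relations
    using presented_super_env_alg[of scale D br L1 Q] by (simp add: \<upsilon>_def[abs_def])
  have filt: "super_env_le scale D br L1 Q = U.filt"
    by (auto simp: fun_eq_iff super_env_le_def U.filt_def tensor_le_def words_less_def less_Suc_eq_le
        \<upsilon>_def tensor_proj_def image_image)
  have generators: "sym_super_gen scale D L1 x = \<sigma> (word_mono [x])"
    "gr_class (super_env_alg scale D br L1 Q) (super_env_le scale D br L1 Q) 1 (super_env_gen scale D br L1 Q x)
      = U.symbol (word_mono [x])" for x
  proof -
    have "super_env_gen scale D br L1 Q x = \<upsilon> (word_mono [x])"
      by (simp add: super_env_gen_def env_gen_def tensor_gen_eq \<upsilon>_def)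
    then show "gr_class (super_env_alg scale D br L1 Q) (super_env_le scale D br L1 Q) 1 (super_env_gen scale D br L1 Q x)
      = U.symbol (word_mono [x])"
      using U.symbol_homogeneous[of 1 "word_mono [x]"] by (simp add: filt homcomp_word_mono)
    show "sym_super_gen scale D L1 x = \<sigma> (word_mono [x])"
      by (simp add: sym_super_gen_def sym_gen_def tensor_gen_eq \<sigma>_def)
  qed
  \<comment> \<open>The kernel of the symbol map is the ideal of relations of \<open>SL/(L1\<^sup>2)\<close>.\<close>
  have vanish: "(\<forall>n. \<upsilon> (homcomp n p) \<in> \<upsilon> ` words_less n) \<longleftrightarrow> p \<in> free_ideal sym_super_relations" for p
  proof
    assume p: "\<forall>n. \<upsilon> (homcomp n p) \<in> \<upsilon> ` words_less n"
    have comp: "homcomp n p \<in> free_ideal sym_super_relations" for n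
    proof -
      obtain t where "t \<in> words_less n" "\<upsilon> (homcomp n p) = \<upsilon> t" using p by blast
      then show ?thesis
        by (intro symbol_of_relation[of _ t n]) (simp_all add: U.pi_eq_iff homcomp_homcomp)
    qed
    obtain N where "p \<in> words_less N" using ex_words_less by blast
    then have "(\<Sum>n<N. homcomp n p) = p" by (rule sum_homcomp) auto
    then show "p \<in> free_ideal sym_super_relations"
      using comp fa.subspace_sum[OF subspace_free_ideal] by metis
  next
    let ?N = "{p. \<forall>n. \<upsilon> (homcomp n p) \<in> \<upsilon> ` words_less n}"
    have homogeneous: "q \<in> ?N"
      if "\<And>n. homcomp n q = (if n = m then q else 0)" "\<upsilon> q = \<upsilon> t" "t \<in> words_less m" for q t m
    proof -
      have "\<zero>\<^bsub>super_env_alg scale D br L1 Q\<^esub> \<in> \<upsilon> ` words_less n" for n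
        using U.pi_zero U.words_less_closed(4) by (metis image_eqI)
      with that show ?thesis by auto
    qed
    have rel: "\<upsilon> q = \<upsilon> (q - s)" if "s \<in> super_env_relations" for q s
      using that free_ideal_superset[of super_env_relations] by (auto simp: U.pi_eq_iff)
    have "sym_super_relations \<subseteq> ?N"
    proof -
      have "q \<in> ?N" if q: "q \<in> multilinear_rels scale" for q
      proof -
        obtain m where "homcomp n q = (if n = m then q else 0)" for n
          using multilinear_rels_homogeneous[OF q] by blast
        moreover have "\<upsilon> q = \<upsilon> 0" using rel[of q q] q by simp
        ultimately show ?thesis using U.words_less_closed(4) by (rule homogeneous)
      qed
      moreover have "q \<in> ?N" if q: "q \<in> sym_word_rels D" for q
      proof -
        obtain x y where q: "q = word_mono [x, y] - word_mono [y, x] - word_mono [D y, D x]"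
          using q by (auto simp: sym_word_rels_def word_mono_append)
        have "q - word_mono [br x y] \<in> super_env_relations"
          by (auto simp: q env_word_rels_def word_mono_append)
        from rel[OF this, of q] show ?thesis
          by (intro homogeneous[of q 2 "word_mono [br x y]"])
            (simp_all add: q homcomp_diff homcomp_word_mono words_less_def)
      qed
      moreover have "q \<in> ?N" if q: "q \<in> square_word_rels L1" for q
      proof -
        obtain y where q: "q = word_mono [y, y]" "y \<in> L1"
          using q by (auto simp: square_word_rels_def word_mono_append)
        have "q - word_mono [Q y] \<in> super_env_relations"
          using q(2) by (auto simp: q(1) super_word_rels_def word_mono_append)
        from rel[OF this, of q] show ?thesis
          by (intro homogeneous[of q 2 "word_mono [Q y]"])
            (simp_all add: q homcomp_word_mono words_less_def)
      qed
      ultimately show ?thesis by blast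
    qed
    from free_ideal_minimal[OF U.ideal_symbol_kernel this]
    show "p \<in> free_ideal sym_super_relations \<Longrightarrow> \<forall>n. \<upsilon> (homcomp n p) \<in> \<upsilon> ` words_less n" by auto
  qed
  have "U.symbol p = U.symbol q \<longleftrightarrow> \<sigma> p = \<sigma> q" for p q
    by (simp add: U.symbol_eq_iff vanish S.pi_eq_iff)
  from S.unique_induced_isomorphism[OF U.symbol_hom U.symbol_surj this]
  show ?thesis
    unfolding natural_maps_def gr_super_env_alg_def generators unfolding filt .
qed

end
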